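(* Let $f(z)=\sum_{n=0}^{\infty}a_nz^n$ be analytic in $\mathbb{D}=\{z\in\mathbb{C}:|z|<1\}$ with $|f(z)|\le 1$ for all $z\in\mathbb{D}$. Then for all $z$ with $|z|=r\le \frac15$, $$\sum_{n=0}^{\infty}|a_n|r^n+\left(\frac{1}{1+|a_0|}+\frac{r}{1-r}\right)\sum_{n=1}^{\infty}|a_n|^2r^{2n}+|f(z)-a_0|+\frac{18}{5}\left(\frac{S_r}{\pi}\right)+\lambda\left(\frac{S_r}{\pi}\right)^2\le 1,$$ where $$\lambda=\frac{(25-\alpha^2)(11125-3810\alpha-2300\alpha^2-30\alpha^3+7\alpha^4)}{2500(1+\alpha)^3(3-5\alpha)}=118.383318\ldots$$ and $\alpha\approx 0.564084$ is the unique root in the interval $(0,1)$ of the equation $$32500-44845t-22435t^2-370t^3+14t^4-t^5+t^6=0.$$ Equality is achieved for the function $f_a(z)=\frac{a-z}{1-az}$ with $a=\alpha$ (at $r=\frac15$, for some $z$ with $|z|=\frac15$).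
   Context: For $f(z)=\sum_{n=0}^\infty a_nz^n$ analytic in $\mathbb{D}$ and $0<r<1$, $S_r=S_r(f)=\int_{|w|<r}|f'(w)|^2\,dA(w)=\pi\sum_{n=1}^{\infty}n|a_n|^2r^{2n}$, where $dA$ is planar Lebesgue measure.
   Formalization: The printed decimal value 118.383318… of λ is wrong for the given closed formula; the formal statement keeps the closed formula and proves the corrected value λ = 118.384394…. *)

theory Defs
  imports "HOL-Complex_Analysis.Complex_Analysis"
begin

definition taylor_coeff :: "(complex \<Rightarrow> complex) \<Rightarrow> nat \<Rightarrow> complex" where
  "taylor_coeff f n = fps_nth (fps_expansion f 0) n"

lemma taylor_coeff_sums:
  assumes "f analytic_on ball 0 1" and "z \<in> ball 0 1"
  shows "(\<lambda>n. taylor_coeff f n * z ^ n) sums f z"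
proof -
  have "f holomorphic_on ball 0 1"
    using assms(1) by (rule analytic_imp_holomorphic)
  from holomorphic_power_series[OF this assms(2)] show ?thesis
    by (simp add: taylor_coeff_def fps_expansion_def)
qed

definition area_S :: "(complex \<Rightarrow> complex) \<Rightarrow> real \<Rightarrow> real" where
  "area_S f r = (LINT w : ball 0 r | lborel. (cmod (deriv f w))\<^sup>2)"

definition alpha_poly :: "real \<Rightarrow> real" where
  "alpha_poly t = 32500 - 44845 * t - 22435 * t ^ 2 - 370 * t ^ 3 + 14 * t ^ 4 - t ^ 5 + t ^ 6"

definition alpha :: real where
  "alpha = (THE t. t \<in> {0<..<1} \<and> alpha_poly t = 0)"

text \<open>
  The numerical value of this constant is 118.384394...; the value 118.383318... that
  appears in the literature next to the same closed form is a rounding error.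
\<close>
definition lambda_const :: real where
  "lambda_const =
     (25 - alpha ^ 2) * (11125 - 3810 * alpha - 2300 * alpha ^ 2 - 30 * alpha ^ 3 + 7 * alpha ^ 4)
       / (2500 * (1 + alpha) ^ 3 * (3 - 5 * alpha))"

text \<open>
  The left-hand side of the inequality at the point \<open>z\<close>, with \<open>r = |z|\<close>.  The second series
  starts at the coefficient of index 1, hence the shift by \<open>Suc\<close>.
\<close>
definition bohr_lhs :: "(complex \<Rightarrow> complex) \<Rightarrow> complex \<Rightarrow> real" where
  "bohr_lhs f z =
     (let r = cmod z; a = taylor_coeff f in
        (\<Sum>n. cmod (a n) * r ^ n)
        + (1 / (1 + cmod (a 0)) + r / (1 - r)) * (\<Sum>n. (cmod (a (Suc n)))\<^sup>2 * r ^ (2 * Suc n))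
        + cmod (f z - a 0)
        + 18 / 5 * (area_S f r / pi)
        + lambda_const * (area_S f r / pi)\<^sup>2)"

definition disc_automorphism :: "real \<Rightarrow> complex \<Rightarrow> complex" where
  "disc_automorphism a z = (of_real a - z) / (1 - of_real a * z)"

end

theory Submission
  imports Defs "HOL-Real_Asymp.Real_Asymp"
begin

text \<open>
  Write \<open>a = |a_0|\<close>.  At \<open>|z| = r\<close> each ingredient of the left-hand side is dominated by its value for the
  Moebius map with parameter \<open>a\<close>:

  \<^item> The two series together are at most \<open>a + (1 - a^2) r / (1 - r)\<close>, by summing Carlson's inequalities
    \<open>|a_(2n+1)| \<le> 1 - |a_0|^2 - ... - |a_n|^2\<close> and
    \<open>|a_(2n)| \<le> 1 - |a_0|^2 - ... - |a_(n-1)|^2 - |a_n|^2 / (1 + |a_0|)\<close>.  These come from testing the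
    contraction \<open>g \<mapsto> f g\<close> on polynomials \<open>g\<close> for which \<open>f g\<close> has few relevant coefficients.
  \<^item> Schwarz's lemma gives \<open>f - a_0 = z h (1 - cnj a_0 f)\<close> with \<open>|h| \<le> 1\<close>.  Pointwise this bounds
    \<open>|f(z) - a_0|\<close>; on coefficients it gives
    \<open>|a_1|^2 + ... + |a_(n+1)|^2 \<le> (1 - a^2)^2 + a^2 (|a_1|^2 + ... + |a_n|^2)\<close>, hence a bound on partial
    sums by those of the Moebius map.  Since \<open>n r^(2n)\<close> decreases for \<open>r^2 \<le> 1/2\<close>, summation by parts
    bounds \<open>S_r\<close>.

  The resulting majorant increases with \<open>r\<close>, and at \<open>r = 1/5\<close> it is at most \<open>1\<close> iff \<open>\<lambda> \<le> R(a)\<close> for an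
  explicit rational function \<open>R\<close>, whose derivative is a negative multiple of the polynomial defining
  \<open>\<alpha>\<close>; thus \<open>R\<close> attains its minimum \<open>\<lambda>\<close> at \<open>\<alpha>\<close>.
\<close>

section \<open>Area integrals over discs\<close>

lemma nn_integral_lborel_translate:
  fixes f :: "complex \<Rightarrow> ennreal"
  assumes [measurable]: "f \<in> borel_measurable borel"
  shows "(\<integral>\<^sup>+x. f (c + x) \<partial>lborel) = (\<integral>\<^sup>+x. f x \<partial>lborel)"
proof -
  have "(\<integral>\<^sup>+x. f x \<partial>lborel) = (\<integral>\<^sup>+x. f x \<partial>distr lborel borel ((+) c))"
    by (simp add: lborel_distr_plus)
  also have "\<dots> = (\<integral>\<^sup>+x. f (c + x) \<partial>lborel)"
    by (subst nn_integral_distr) auto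
  finally show ?thesis by simp
qed

text \<open>
  Integrate \<open>f(u x) g(y - u x)\<close> over \<open>x\<close> and \<open>y\<close> in both orders, where \<open>g\<close> is the indicator of the
  rotation-invariant unit disc; translation invariance then compares the two integrals of \<open>f\<close>.
\<close>

lemma nn_integral_lborel_rotate:
  fixes f :: "complex \<Rightarrow> ennreal"
  assumes [measurable]: "f \<in> borel_measurable borel" and u: "cmod u = 1"
  shows "(\<integral>\<^sup>+x. f (u * x) \<partial>lborel) = (\<integral>\<^sup>+x. f x \<partial>lborel)"
proof -
  define g :: "complex \<Rightarrow> ennreal" where "g = indicator (ball 0 1)"
  have [measurable]: "g \<in> borel_measurable borel"
    unfolding g_def by (intro borel_measurable_indicator) simp
  have u0: "u \<noteq> 0" using u by auto
  let ?G = "\<integral>\<^sup>+y. g y \<partial>lborel"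
  have G: "?G = ennreal pi"
    by (simp add: g_def emeasure_ball unit_ball_vol_2)
  have "(\<integral>\<^sup>+x. f (u * x) \<partial>lborel) * ?G
      = (\<integral>\<^sup>+x. f (u * x) * ?G \<partial>lborel)"
    by (simp add: nn_integral_multc)
  also have "\<dots> = (\<integral>\<^sup>+x. f (u * x) * (\<integral>\<^sup>+y. g (- (u * x) + y) \<partial>lborel) \<partial>lborel)"
    by (subst nn_integral_lborel_translate) simp_all
  also have "\<dots> = (\<integral>\<^sup>+x. (\<integral>\<^sup>+y. f (u * x) * g (- (u * x) + y) \<partial>lborel) \<partial>lborel)"
    by (simp add: nn_integral_cmult)
  also have "\<dots> = (\<integral>\<^sup>+y. (\<integral>\<^sup>+x. f (u * x) * g (- (u * x) + y) \<partial>lborel) \<partial>lborel)"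
    by (rule lborel_pair.Fubini'[symmetric]) measurable
  \<comment> \<open>Translating x by \<open>y / u\<close> moves the dependence on y from
    \<open>g\<close> to \<open>f\<close>.\<close>
  also have "\<dots> = (\<integral>\<^sup>+y. (\<integral>\<^sup>+x. f (u * (y / u + x)) * g (- (u * (y / u + x)) + y) \<partial>lborel) \<partial>lborel)"
  proof (rule nn_integral_cong)
    fix y :: complex
    show "(\<integral>\<^sup>+x. f (u * x) * g (- (u * x) + y) \<partial>lborel)
        = (\<integral>\<^sup>+x. f (u * (y / u + x)) * g (- (u * (y / u + x)) + y) \<partial>lborel)"
      by (rule nn_integral_lborel_translate[of "\<lambda>x. f (u * x) * g (- (u * x) + y)", symmetric])
         measurable
  qed
  also have "\<dots> = (\<integral>\<^sup>+y. (\<integral>\<^sup>+x. f (u * x + y) * g x \<partial>lborel) \<partial>lborel)"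
  proof (intro nn_integral_cong)
    fix x y :: complex
    have "u * (y / u + x) = u * x + y" using u0 by (simp add: field_simps)
    moreover have "g (- (u * x + y) + y) = g x"
      using u by (simp add: g_def indicator_def norm_mult)
    ultimately show "f (u * (y / u + x)) * g (- (u * (y / u + x)) + y) = f (u * x + y) * g x"
      by simp
  qed
  also have "\<dots> = (\<integral>\<^sup>+x. (\<integral>\<^sup>+y. f (u * x + y) * g x \<partial>lborel) \<partial>lborel)"
    by (rule lborel_pair.Fubini') measurable
  also have "\<dots> = (\<integral>\<^sup>+x. (\<integral>\<^sup>+y. f (u * x + y) \<partial>lborel) * g x \<partial>lborel)"
    by (simp add: nn_integral_multc)
  also have "\<dots> = (\<integral>\<^sup>+x. (\<integral>\<^sup>+y. f y \<partial>lborel) * g x \<partial>lborel)"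
    by (subst nn_integral_lborel_translate) simp_all
  also have "\<dots> = (\<integral>\<^sup>+y. f y \<partial>lborel) * ?G"
    by (simp add: nn_integral_cmult)
  finally have "(\<integral>\<^sup>+x. f (u * x) \<partial>lborel) * ?G = (\<integral>\<^sup>+y. f y \<partial>lborel) * ?G" .
  thus ?thesis
    unfolding G by (simp add: mult.commute[of _ "ennreal pi"] ennreal_mult_cancel_left)
qed

lemma lborel_distr_rotate:
  assumes "cmod u = 1"
  shows "distr lborel borel (\<lambda>z. u * z) = lborel"
proof (rule measure_eqI)
  fix A assume "A \<in> sets (distr lborel borel (\<lambda>z. u * z))"
  hence [measurable]: "A \<in> sets borel" by simp
  have "emeasure (distr lborel borel (\<lambda>z. u * z)) A
      = (\<integral>\<^sup>+x. indicator A x \<partial>distr lborel borel (\<lambda>z. u * z))"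
    by simp
  also have "\<dots> = (\<integral>\<^sup>+x. indicator A (u * x) \<partial>lborel)"
    by (rule nn_integral_distr) auto
  also have "\<dots> = emeasure lborel A"
    using assms by (subst nn_integral_lborel_rotate) auto
  finally show "emeasure (distr lborel borel (\<lambda>z. u * z)) A = emeasure lborel A" .
qed simp

section \<open>Orthogonality of monomials on discs\<close>

lemma set_integrable_ball:
  fixes g :: "complex \<Rightarrow> 'b :: {banach, second_countable_topology}"
  assumes "continuous_on (cball 0 r) g"
  shows "set_integrable lborel (ball 0 r) g"
proof -
  have "set_integrable lborel (cball 0 r) g"
    using assms unfolding set_integrable_def
    by (intro borel_integrable_compact) auto
  thus ?thesis by (rule set_integrable_subset) auto
qed

text \<open>Rotation by \<open>u\<close> preserves the disc and the measure but multiplies the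
  integrand by -1, so the integral equals its own negative.\<close>

lemma integral_ball_moment_off_diagonal:
  assumes "n < m"
  shows "(LINT z : ball 0 r | lborel. z ^ m * cnj z ^ n) = 0"
proof -
  \<comment> \<open>The angle is chosen to make \<open>u ^ (m - n)\<close> equal to -1.\<close>
  define u where "u = cis (pi / of_nat (m - n))"
  have u: "cmod u = 1" by (simp add: u_def)
  have "u ^ m * cnj u ^ n = u ^ (m - n) * (u * cnj u) ^ n"
    using assms by (simp add: power_mult_distrib flip: power_add)
  also have "u * cnj u = 1" using u by (simp add: complex_norm_square[symmetric])
  also have "u ^ (m - n) = -1"
  proof -
    have "real (m - n) * (pi / real (m - n)) = pi" using assms by simp
    thus ?thesis by (simp only: u_def Complex.DeMoivre cis_pi)
  qed
  finally have um: "u ^ m * cnj u ^ n = -1" by simp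
  let ?h = "\<lambda>z. indicat_real (ball 0 r) z *\<^sub>R (z ^ m * cnj z ^ n)"
  have "(\<integral>z. ?h z \<partial>lborel) = (\<integral>z. ?h z \<partial>distr lborel borel (\<lambda>z. u * z))"
    by (simp add: lborel_distr_rotate u)
  also have "\<dots> = (\<integral>z. ?h (u * z) \<partial>lborel)"
  proof (rule integral_distr)
    have "set_integrable lborel (ball 0 r) (\<lambda>z. z ^ m * cnj z ^ n)"
      by (intro set_integrable_ball continuous_intros)
    thus "?h \<in> borel_measurable borel"
      by (auto simp: set_integrable_def dest!: borel_measurable_integrable)
  qed simp
  also have "\<dots> = (\<integral>z. - ?h z \<partial>lborel)"
  proof (rule Bochner_Integration.integral_cong)
    fix z
    have "(u * z) ^ m * cnj (u * z) ^ n = (u ^ m * cnj u ^ n) * (z ^ m * cnj z ^ n)"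
      by (simp add: power_mult_distrib mult_ac)
    thus "?h (u * z) = - ?h z" using u by (simp add: um norm_mult indicator_def)
  qed simp
  finally show ?thesis by (simp add: set_lebesgue_integral_def)
qed

text \<open>
  Layer cake: integrate \<open>2 n t^(2n-1)\<close> over the region \<open>|z| \<le> t \<le> r\<close> in both orders.
\<close>

lemma integral_ball_moment:
  assumes "0 \<le> r"
  shows "(LINT z : ball 0 r | lborel. cmod z ^ (2 * n)) = pi * r ^ (2 * n + 2) / (n + 1)"
proof -
  define h where "h t = 2 * n * t ^ (2 * n - 1)" for t :: real
  define F where "F z t = ennreal (h t) * indicator {cmod z..r} t" for z t
  have [measurable]: "(\<lambda>(z, t). F z t) \<in> borel_measurable (borel \<Otimes>\<^sub>M borel)"
    unfolding F_def h_def indicator_def atLeastAtMost_iff by measurable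
  have inner: "(\<integral>\<^sup>+t. F z t \<partial>lborel) = ennreal (r ^ (2 * n) - cmod z ^ (2 * n)) * indicator (ball 0 r) z" for z
  proof (cases "cmod z < r")
    case True
    have "(\<integral>\<^sup>+t. ennreal (h t) * indicator {cmod z..r} t \<partial>lborel) = ennreal (r ^ (2 * n) - cmod z ^ (2 * n))"
    proof (rule nn_integral_FTC_Icc)
      show "DERIV (\<lambda>t. t ^ (2 * n)) t :> h t" for t
        unfolding h_def by (auto intro!: derivative_eq_intros)
      show "0 \<le> h t" if "t \<in> {cmod z..r}" for t
        using that order_trans[OF norm_ge_zero, of z t] unfolding h_def
        by (intro mult_nonneg_nonneg zero_le_power) auto
    qed (use True in \<open>auto simp: h_def\<close>)
    with True show ?thesis by (simp add: F_def)
  next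
    case False
    \<comment> \<open>For |z| >= r the region in t is empty or the single point t = r, a null
      set.\<close>
    have "AE t in lborel. F z t = 0"
      using AE_lborel_singleton[of r] by eventually_elim (use False in \<open>auto simp: F_def indicator_def\<close>)
    thus ?thesis using False by (simp add: nn_integral_cong_AE)
  qed
  have outer: "(\<integral>\<^sup>+z. F z t \<partial>lborel) = ennreal (2 * n * pi * t ^ (2 * n + 1)) * indicator {0..r} t" for t
  proof (cases "0 \<le> t \<and> t \<le> r")
    case True
    have "(\<integral>\<^sup>+z. F z t \<partial>lborel) = (\<integral>\<^sup>+z. ennreal (h t) * indicator (cball (0 :: complex) t) z \<partial>lborel)"
      using True by (intro nn_integral_cong) (auto simp: F_def indicator_def)
    also have "\<dots> = ennreal (h t) * ennreal (pi * t\<^sup>2)"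
      using True
      by (subst nn_integral_cmult_indicator) (simp_all add: emeasure_cball unit_ball_vol_2)
    also have "\<dots> = ennreal (h t * (pi * t\<^sup>2))"
      using True by (intro ennreal_mult[symmetric]) (auto simp: h_def)
    also have "h t * (pi * t\<^sup>2) = 2 * n * pi * t ^ (2 * n + 1)"
      by (cases n) (auto simp: h_def power2_eq_square)
    finally show ?thesis using True by simp
  next
    case False
    hence "F z t = 0" for z
      using norm_ge_zero[of z] by (auto simp: F_def indicator_def simp del: norm_ge_zero)
    thus ?thesis using False by auto
  qed
  have "(\<integral>\<^sup>+z. ennreal (r ^ (2 * n) - cmod z ^ (2 * n)) * indicator (ball 0 r) z \<partial>lborel)
      = (\<integral>\<^sup>+t. ennreal (2 * n * pi * t ^ (2 * n + 1)) * indicator {0..r} t \<partial>lborel)"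
    unfolding inner[symmetric] outer[symmetric] by (rule lborel_pair.Fubini'[symmetric]) measurable
  also have "\<dots> = ennreal (n * pi * r ^ (2 * n + 2) / (n + 1) - n * pi * 0 ^ (2 * n + 2) / (n + 1))"
  proof (rule nn_integral_FTC_Icc)
    show "DERIV (\<lambda>t. n * pi * t ^ (2 * n + 2) / (n + 1)) t :> 2 * n * pi * t ^ (2 * n + 1)" for t
    proof -
      have "DERIV (\<lambda>t. n * pi / (n + 1) * t ^ (2 * n + 2)) t :> n * pi / (n + 1) * ((2 * n + 2) * t ^ (2 * n + 1))"
        by (rule DERIV_cmult, rule DERIV_pow[THEN DERIV_cong]) simp
      also have "n * pi / (n + 1) * ((2 * n + 2) * t ^ (2 * n + 1)) = 2 * n * pi * t ^ (2 * n + 1)"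
        by (simp add: divide_simps)
      finally show ?thesis by simp
    qed
  qed (use assms in auto)
  finally have eq: "(\<integral>\<^sup>+z. ennreal (r ^ (2 * n) - cmod z ^ (2 * n)) * indicator (ball 0 r) z \<partial>lborel)
      = ennreal (n * pi * r ^ (2 * n + 2) / (n + 1))" by simp
  have int: "set_integrable lborel (ball 0 r) (\<lambda>z. cmod z ^ (2 * n))"
    by (intro set_integrable_ball continuous_intros)
  \<comment> \<open>The layer cake yields this complementary integral; subtracting it from
    \<open>r ^ (2 * n)\<close> times the area of the disc recovers the moment.\<close>
  have "(LINT z : ball 0 r | lborel. r ^ (2 * n) - cmod z ^ (2 * n)) = n * pi * r ^ (2 * n + 2) / (n + 1)"
    unfolding set_lebesgue_integral_def
  proof (rule integral_eq_nn_integral[THEN trans])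
    show "AE z in lborel. 0 \<le> indicat_real (ball 0 r) z *\<^sub>R (r ^ (2 * n) - cmod z ^ (2 * n))"
      by (intro AE_I2) (auto simp: indicator_def intro!: power_mono)
    have "(\<integral>\<^sup>+z. ennreal (indicat_real (ball 0 r) z *\<^sub>R (r ^ (2 * n) - cmod z ^ (2 * n))) \<partial>lborel)
        = (\<integral>\<^sup>+z. ennreal (r ^ (2 * n) - cmod z ^ (2 * n)) * indicator (ball 0 r) z \<partial>lborel)"
      by (intro nn_integral_cong) (auto simp: indicator_def)
    thus "enn2real (\<integral>\<^sup>+z. ennreal (indicat_real (ball 0 r) z *\<^sub>R (r ^ (2 * n) - cmod z ^ (2 * n))) \<partial>lborel)
        = n * pi * r ^ (2 * n + 2) / (n + 1)"
      using assms by (simp add: eq)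
    have "set_integrable lborel (ball 0 r) (\<lambda>z. r ^ (2 * n) - cmod z ^ (2 * n))"
      by (intro set_integrable_ball continuous_intros)
    thus "(\<lambda>z. indicat_real (ball 0 r) z *\<^sub>R (r ^ (2 * n) - cmod z ^ (2 * n))) \<in> borel_measurable lborel"
      by (simp add: set_integrable_def borel_measurable_integrable)
  qed
  also have "(LINT z : ball 0 r | lborel. r ^ (2 * n) - cmod z ^ (2 * n))
      = (LINT z : ball (0 :: complex) r | lborel. r ^ (2 * n)) - (LINT z : ball 0 r | lborel. cmod z ^ (2 * n))"
    by (rule set_integral_diff(2)[OF _ int], rule set_integrable_ball, rule continuous_on_const)
  also have "(LINT z : ball (0 :: complex) r | lborel. r ^ (2 * n)) = pi * r ^ (2 * n + 2)"
  proof -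
    have "measure lborel (ball (0 :: complex) r) = pi * r\<^sup>2"
      using assms by (simp add: measure_def emeasure_ball unit_ball_vol_2)
    moreover have "emeasure lborel (ball (0 :: complex) r) \<noteq> \<infinity>"
      using emeasure_lborel_ball_finite[of "0 :: complex" r] by simp
    ultimately show ?thesis
      by (subst set_integral_const) (auto simp: power_add power2_eq_square)
  qed
  finally have "(LINT z : ball 0 r | lborel. cmod z ^ (2 * n))
      = pi * r ^ (2 * n + 2) - n * pi * r ^ (2 * n + 2) / (n + 1)" by linarith
  also have "\<dots> = pi * r ^ (2 * n + 2) / (n + 1)"
    by (simp add: divide_simps) (simp add: algebra_simps)
  finally show ?thesis .
qed

lemma integral_ball_monomials:
  assumes "0 \<le> r"
  shows "(LINT z : ball 0 r | lborel. z ^ m * cnj z ^ n)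
    = (if m = n then of_real (pi * r ^ (2 * n + 2) / (n + 1)) else 0)"
proof (cases m n rule: linorder_cases)
  case greater
  thus ?thesis using integral_ball_moment_off_diagonal[of n m r] by simp
next
  case less
  \<comment> \<open>Conjugation exchanges the exponents and reduces this case to the previous
    one.\<close>
  have "(LINT z : ball 0 r | lborel. cnj (z ^ n * cnj z ^ m)) = cnj (LINT z : ball 0 r | lborel. z ^ n * cnj z ^ m)"
    unfolding set_lebesgue_integral_def
    by (subst Bochner_Integration.integral_cnj[symmetric], intro Bochner_Integration.integral_cong) auto
  thus ?thesis using less integral_ball_moment_off_diagonal[of m n r] by (simp add: mult.commute)
next
  case equal
  have "z ^ n * cnj z ^ n = of_real (cmod z ^ (2 * n))" for z
    by (simp only: power_mult power_mult_distrib[symmetric] complex_norm_square[symmetric] of_real_power)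
  thus ?thesis
    using equal integral_ball_moment[OF assms, of n] set_integral_complex_of_real[of lborel "ball 0 r" "\<lambda>z. cmod z ^ (2 * n)"] by simp
qed

section \<open>Parseval's identity with area weights and comparison of coefficients\<close>

lemma set_integrable_sum:
  fixes f :: "'i \<Rightarrow> 'a \<Rightarrow> 'b :: {banach, second_countable_topology}"
  assumes "\<And>i. i \<in> I \<Longrightarrow> set_integrable M A (f i)"
  shows "set_integrable M A (\<lambda>x. \<Sum>i\<in>I. f i x)"
  using assms unfolding set_integrable_def scaleR_sum_right by (rule Bochner_Integration.integrable_sum)

lemma set_integral_sum:
  fixes f :: "'i \<Rightarrow> 'a \<Rightarrow> 'b :: {banach, second_countable_topology}"
  assumes "\<And>i. i \<in> I \<Longrightarrow> set_integrable M A (f i)"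
  shows "(LINT x : A | M. \<Sum>i\<in>I. f i x) = (\<Sum>i\<in>I. LINT x : A | M. f i x)"
  using assms unfolding set_integrable_def set_lebesgue_integral_def scaleR_sum_right
  by (rule Bochner_Integration.integral_sum)

text \<open>Expanding the square as the polynomial times its conjugate gives a double sum in which
  orthogonality leaves only the diagonal.\<close>

lemma integral_ball_polynomial_square:
  fixes b :: "nat \<Rightarrow> complex"
  assumes "0 \<le> r"
  shows "(LINT z : ball 0 r | lborel. (cmod (\<Sum>n<N. b n * z ^ n))\<^sup>2)
    = (\<Sum>n<N. pi * r ^ (2 * n + 2) / (n + 1) * (cmod (b n))\<^sup>2)"
proof -
  have int: "set_integrable lborel (ball 0 r) (\<lambda>z. b m * cnj (b n) * (z ^ m * cnj z ^ n))" for m n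
    by (intro set_integrable_ball continuous_intros)
  have "complex_of_real (LINT z : ball 0 r | lborel. (cmod (\<Sum>n<N. b n * z ^ n))\<^sup>2)
      = (LINT z : ball 0 r | lborel. (\<Sum>m<N. b m * z ^ m) * cnj (\<Sum>n<N. b n * z ^ n))"
    by (simp only: set_integral_complex_of_real[symmetric] complex_norm_square)
  also have "\<dots> = (LINT z : ball 0 r | lborel. (\<Sum>m<N. \<Sum>n<N. b m * cnj (b n) * (z ^ m * cnj z ^ n)))"
    by (simp add: sum_product mult_ac)
  also have "\<dots> = (\<Sum>m<N. \<Sum>n<N. (LINT z : ball 0 r | lborel. b m * cnj (b n) * (z ^ m * cnj z ^ n)))"
    by (subst set_integral_sum, rule set_integrable_sum, rule int, subst set_integral_sum, rule int, rule refl)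
  also have "\<dots> = (\<Sum>m<N. b m * cnj (b m) * of_real (pi * r ^ (2 * m + 2) / (m + 1)))"
    unfolding set_integral_mult_right integral_ball_monomials[OF assms]
    by (intro sum.cong refl) (simp add: if_distrib cong: if_cong)
  also have "\<dots> = of_real (\<Sum>n<N. pi * r ^ (2 * n + 2) / (n + 1) * (cmod (b n))\<^sup>2)"
    unfolding complex_norm_square[symmetric] of_real_mult[symmetric] of_real_sum[symmetric]
    by (simp add: mult.commute)
  finally show ?thesis by (simp only: of_real_eq_iff)
qed

text \<open>Strictness of the hypothesis puts the closed disc inside the region of convergence. The
  factor \<open>z ^ K\<close> serves the reweighting of coefficients below.\<close>

lemma set_integrable_shifted_eval_fps:
  fixes F :: "complex fps"
  assumes "ereal r < fps_conv_radius F"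
  shows "set_integrable lborel (ball 0 r) (\<lambda>z. (cmod (z ^ K * eval_fps F z))\<^sup>2)"
proof -
  have "ereal (cmod z) < fps_conv_radius F" if "cmod z \<le> r" for z :: complex
    using assms that by (meson ereal_less_eq(3) le_less_trans)
  thus ?thesis by (intro set_integrable_ball continuous_intros) auto
qed

text \<open>The truncations converge pointwise on the disc and are bounded by the constant
  \<open>M\<close>, the absolutely convergent series at radius r; dominated convergence carries the
  polynomial identity to the limit.\<close>

lemma area_parseval:
  fixes F :: "complex fps"
  assumes r: "0 \<le> r" "ereal r < fps_conv_radius F"
  shows "(\<lambda>n. pi * r ^ (2 * n + 2) / (n + 1) * (cmod (fps_nth F n))\<^sup>2) sums
    (LINT z : ball 0 r | lborel. (cmod (eval_fps F z))\<^sup>2)"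
proof -
  define P where "P N z = (\<Sum>n<N. fps_nth F n * z ^ n)" for N z
  define M where "M = (\<Sum>n. cmod (fps_nth F n) * r ^ n)"
  have sm: "summable (\<lambda>n. cmod (fps_nth F n) * r ^ n)"
    using norm_summable_fps[of "of_real r" F] r by (simp add: norm_mult norm_power)
  have bound: "cmod (P N z) \<le> M" if "cmod z < r" for N z
  proof -
    have "cmod (P N z) \<le> (\<Sum>n<N. cmod (fps_nth F n) * r ^ n)"
      unfolding P_def using that
      by (intro sum_norm_le) (auto simp: norm_mult norm_power intro!: mult_left_mono power_mono)
    also have "\<dots> \<le> M"
      unfolding M_def using r by (intro sum_le_suminf sm) auto
    finally show ?thesis .
  qed
  have "(\<lambda>N. LINT z | lborel. indicat_real (ball 0 r) z *\<^sub>R (cmod (P N z))\<^sup>2)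
      \<longlonglongrightarrow> (LINT z | lborel. indicat_real (ball 0 r) z *\<^sub>R (cmod (eval_fps F z))\<^sup>2)"
  proof (rule integral_dominated_convergence[where w = "\<lambda>z. indicat_real (ball 0 r) z *\<^sub>R M\<^sup>2"])
    show "(\<lambda>z. indicat_real (ball 0 r) z *\<^sub>R (cmod (eval_fps F z))\<^sup>2) \<in> borel_measurable lborel"
      using set_integrable_shifted_eval_fps[OF r(2), of 0] by (simp add: set_integrable_def borel_measurable_integrable)
    have "set_integrable lborel (ball 0 r) (\<lambda>z. (cmod (P N z))\<^sup>2)" for N
      unfolding P_def by (intro set_integrable_ball continuous_intros)
    thus "(\<lambda>z. indicat_real (ball 0 r) z *\<^sub>R (cmod (P N z))\<^sup>2) \<in> borel_measurable lborel" for N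
      by (simp add: set_integrable_def borel_measurable_integrable)
    have "set_integrable lborel (ball 0 r) (\<lambda>z :: complex. M\<^sup>2)"
      by (intro set_integrable_ball continuous_intros)
    thus "integrable lborel (\<lambda>z :: complex. indicat_real (ball 0 r) z *\<^sub>R M\<^sup>2)"
      by (simp add: set_integrable_def)
    show "AE z in lborel. (\<lambda>N. indicat_real (ball 0 r) z *\<^sub>R (cmod (P N z))\<^sup>2)
        \<longlonglongrightarrow> indicat_real (ball 0 r) z *\<^sub>R (cmod (eval_fps F z))\<^sup>2"
    proof (intro AE_I2)
      fix z :: complex
      show "(\<lambda>N. indicat_real (ball 0 r) z *\<^sub>R (cmod (P N z))\<^sup>2)
        \<longlonglongrightarrow> indicat_real (ball 0 r) z *\<^sub>R (cmod (eval_fps F z))\<^sup>2"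
      proof (cases "cmod z < r")
        case True
        hence "ereal (cmod z) < fps_conv_radius F" using r by (meson less_ereal.simps(1) less_trans)
        hence "(\<lambda>N. P N z) \<longlonglongrightarrow> eval_fps F z"
          using sums_eval_fps unfolding P_def sums_def by blast
        thus ?thesis by (intro tendsto_intros)
      qed auto
    qed
    show "AE z in lborel. norm (indicat_real (ball 0 r) z *\<^sub>R (cmod (P N z))\<^sup>2)
        \<le> indicat_real (ball 0 r) z *\<^sub>R M\<^sup>2" for N
      using bound by (intro AE_I2) (auto simp: indicator_def intro!: power_mono)
  qed
  thus ?thesis
    unfolding sums_def P_def set_lebesgue_integral_def[symmetric] integral_ball_polynomial_square[OF r(1)] .
qed

text \<open>Apply \<open>area_parseval\<close> to \<open>fps_X ^ K * F\<close>: its first K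
  coefficients vanish, so dropping them only shifts the index.\<close>

lemma area_parseval_shift:
  fixes F :: "complex fps"
  assumes r: "0 \<le> r" "ereal r < fps_conv_radius F"
  shows "(\<lambda>n. pi * r ^ (2 * (n + K) + 2) / (n + K + 1) * (cmod (fps_nth F n))\<^sup>2) sums
    (LINT z : ball 0 r | lborel. (cmod (z ^ K * eval_fps F z))\<^sup>2)"
proof -
  define H where "H = fps_X ^ K * F"
  have rH: "ereal r < fps_conv_radius H"
    using fps_conv_radius_mult[of "fps_X ^ K" F] r by (simp add: H_def)
  have "(LINT z : ball 0 r | lborel. (cmod (eval_fps H z))\<^sup>2)
      = (LINT z : ball 0 r | lborel. (cmod (z ^ K * eval_fps F z))\<^sup>2)"
  proof (rule set_lebesgue_integral_cong)
    show "\<forall>z. z \<in> ball 0 r \<longrightarrow> (cmod (eval_fps H z))\<^sup>2 = (cmod (z ^ K * eval_fps F z))\<^sup>2"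
    proof (intro allI impI)
      fix z :: complex assume "z \<in> ball 0 r"
      hence "ereal (cmod z) < fps_conv_radius F" using r by (auto intro: less_trans[of _ "ereal r"])
      thus "(cmod (eval_fps H z))\<^sup>2 = (cmod (z ^ K * eval_fps F z))\<^sup>2"
        by (simp add: H_def eval_fps_mult)
    qed
  qed simp
  moreover have "(\<lambda>n. pi * r ^ (2 * (n + K) + 2) / (n + K + 1) * (cmod (fps_nth H (n + K)))\<^sup>2) sums
    ((LINT z : ball 0 r | lborel. (cmod (eval_fps H z))\<^sup>2)
      - (\<Sum>n<K. pi * r ^ (2 * n + 2) / (n + 1) * (cmod (fps_nth H n))\<^sup>2))"
    by (rule sums_split_initial_segment[OF area_parseval[OF r(1) rH]])
  ultimately show ?thesis
    by (simp add: H_def fps_X_power_mult_nth add_ac)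
qed

text \<open>
  The area weights \<open>1 / (n + 1)\<close> are not the constant weights needed here.  Multiplying both functions by
  \<open>z^K\<close> turns them into \<open>1 / (n + K + 1)\<close>, which become constant up to scaling as \<open>K\<close> grows.
\<close>

lemma coefficient_norm_mono:
  fixes F G :: "complex fps"
  assumes F: "1 \<le> fps_conv_radius F" and G: "1 \<le> fps_conv_radius G"
    and le: "\<And>z. cmod z < 1 \<Longrightarrow> cmod (eval_fps F z) \<le> cmod (eval_fps G z)"
    and C: "\<And>n. (\<Sum>k<n. (cmod (fps_nth G k))\<^sup>2) \<le> C"
  shows "(\<Sum>k<N. (cmod (fps_nth F k))\<^sup>2) \<le> C"
proof -
  have key: "(\<Sum>n<N. (cmod (fps_nth F n))\<^sup>2 * (r ^ (2 * n) * ((real K + 1) / (real n + real K + 1)))) \<le> C"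
    if r: "0 < r" "r < 1" for r K
  proof -
    have rF: "ereal r < fps_conv_radius F" using F r(2) by (metis ereal_less(3) less_le_trans)
    have rG: "ereal r < fps_conv_radius G" using G r(2) by (metis ereal_less(3) less_le_trans)
    \<comment> \<open>\<open>c\<close> is the weight at n = 0; dividing by it leaves factors that
      are at most 1 and tend to \<open>r ^ (2 * n)\<close> as K grows.\<close>
    define c where "c = pi * r ^ (2 * K + 2) / (K + 1)"
    have c: "c > 0" using r by (simp add: c_def)
    have weight: "pi * r ^ (2 * (n + K) + 2) / (n + K + 1) = c * (r ^ (2 * n) * ((real K + 1) / (real n + real K + 1)))" for n
      by (simp add: c_def power_add add_ac)
    note PF = area_parseval_shift[OF less_imp_le[OF r(1)] rF, of K, unfolded weight]
    note PG = area_parseval_shift[OF less_imp_le[OF r(1)] rG, of K, unfolded weight]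
    have "c * (\<Sum>n<N. (cmod (fps_nth F n))\<^sup>2 * (r ^ (2 * n) * ((real K + 1) / (real n + real K + 1))))
        = (\<Sum>n<N. c * (r ^ (2 * n) * ((real K + 1) / (real n + real K + 1))) * (cmod (fps_nth F n))\<^sup>2)"
      by (simp add: sum_distrib_left mult_ac)
    also have "\<dots> \<le> (LINT z : ball 0 r | lborel. (cmod (z ^ K * eval_fps F z))\<^sup>2)"
      unfolding sums_unique[OF PF]
      by (rule sum_le_suminf[OF sums_summable[OF PF]]) (use c r in auto)
    also have "\<dots> \<le> (LINT z : ball 0 r | lborel. (cmod (z ^ K * eval_fps G z))\<^sup>2)"
      using r by (intro set_integral_mono set_integrable_shifted_eval_fps rF rG)
        (auto simp: norm_mult intro!: power_mono mult_left_mono le)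
    also have "\<dots> \<le> c * C"
      unfolding sums_unique[OF PG]
    proof (rule suminf_le_const[OF sums_summable[OF PG]])
      fix m
      have "(\<Sum>n<m. c * (r ^ (2 * n) * ((real K + 1) / (real n + real K + 1))) * (cmod (fps_nth G n))\<^sup>2)
          \<le> (\<Sum>n<m. c * (1 * 1) * (cmod (fps_nth G n))\<^sup>2)"
        using c r by (intro sum_mono mult_right_mono mult_left_mono mult_mono) (auto intro: power_le_one)
      also have "\<dots> = c * (\<Sum>n<m. (cmod (fps_nth G n))\<^sup>2)"
        by (simp add: sum_distrib_left)
      also have "\<dots> \<le> c * C" using c C by simp
      finally show "(\<Sum>n<m. c * (r ^ (2 * n) * ((real K + 1) / (real n + real K + 1))) * (cmod (fps_nth G n))\<^sup>2) \<le> c * C" .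
    qed
    finally show ?thesis using c by simp
  qed
  have "(\<Sum>n<N. (cmod (fps_nth F n))\<^sup>2 * r ^ (2 * n)) \<le> C" if r: "0 < r" "r < 1" for r
  proof (rule LIMSEQ_le_const2)
    have "(\<lambda>K. (real K + 1) / (real n + real K + 1)) \<longlonglongrightarrow> 1" for n by real_asymp
    hence "(\<lambda>K. \<Sum>n<N. (cmod (fps_nth F n))\<^sup>2 * (r ^ (2 * n) * ((real K + 1) / (real n + real K + 1))))
        \<longlonglongrightarrow> (\<Sum>n<N. (cmod (fps_nth F n))\<^sup>2 * (r ^ (2 * n) * 1))"
      by (intro tendsto_intros)
    thus "(\<lambda>K. \<Sum>n<N. (cmod (fps_nth F n))\<^sup>2 * (r ^ (2 * n) * ((real K + 1) / (real n + real K + 1))))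
        \<longlonglongrightarrow> (\<Sum>n<N. (cmod (fps_nth F n))\<^sup>2 * r ^ (2 * n))" by simp
  qed (use key[OF r] in blast)
  \<comment> \<open>With K gone, r may tend to 1; the sum is finite, so the limit is taken
    termwise.\<close>
  hence *: "eventually (\<lambda>r. (\<Sum>n<N. (cmod (fps_nth F n))\<^sup>2 * r ^ (2 * n)) \<le> C) (at_left 1)"
    by (intro eventually_at_leftI[of 0]) auto
  have "((\<lambda>r. \<Sum>n<N. (cmod (fps_nth F n))\<^sup>2 * r ^ (2 * n)) \<longlongrightarrow> (\<Sum>n<N. (cmod (fps_nth F n))\<^sup>2 * 1 ^ (2 * n))) (at_left 1)"
    by (intro tendsto_intros)
  from tendsto_upperbound[OF this *] show ?thesis by simp
qed

section \<open>The normalized area as a coefficient series\<close>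

text \<open>Parseval for the derivative: its coefficients contribute the square of n + 1, one factor
  of which cancels against the area weight.\<close>

lemma area_series:
  fixes A :: "complex fps"
  assumes r: "0 \<le> r" "ereal r < fps_conv_radius A"
  shows "(\<lambda>n. real (Suc n) * r ^ (2 * Suc n) * (cmod (fps_nth A (Suc n)))\<^sup>2) sums
    ((LINT z : ball 0 r | lborel. (cmod (deriv (eval_fps A) z))\<^sup>2) / pi)"
proof -
  have "ereal r < fps_conv_radius (fps_deriv A)"
    using r fps_conv_radius_deriv[of A] by (auto intro: less_le_trans)
  from sums_divide[OF area_parseval[OF r(1) this], of pi]
  have "(\<lambda>n. pi * r ^ (2 * n + 2) / real (n + 1) * (cmod (fps_nth (fps_deriv A) n))\<^sup>2 / pi) sums
    ((LINT z : ball 0 r | lborel. (cmod (eval_fps (fps_deriv A) z))\<^sup>2) / pi)" .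
  also have "(\<lambda>n. pi * r ^ (2 * n + 2) / real (n + 1) * (cmod (fps_nth (fps_deriv A) n))\<^sup>2 / pi)
      = (\<lambda>n. real (Suc n) * r ^ (2 * Suc n) * (cmod (fps_nth A (Suc n)))\<^sup>2)"
  proof
    fix n
    have "cmod (fps_nth (fps_deriv A) n) = real (Suc n) * cmod (fps_nth A (Suc n))"
      by (simp add: norm_mult del: of_nat_Suc)
    thus "pi * r ^ (2 * n + 2) / real (n + 1) * (cmod (fps_nth (fps_deriv A) n))\<^sup>2 / pi
        = real (Suc n) * r ^ (2 * Suc n) * (cmod (fps_nth A (Suc n)))\<^sup>2"
      by (simp add: power_mult_distrib power2_eq_square[of "real (Suc n)"] del: of_nat_Suc)
  qed
  also have "(LINT z : ball 0 r | lborel. (cmod (eval_fps (fps_deriv A) z))\<^sup>2)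
      = (LINT z : ball 0 r | lborel. (cmod (deriv (eval_fps A) z))\<^sup>2)"
  proof (rule set_lebesgue_integral_cong)
    show "\<forall>z. z \<in> ball 0 r \<longrightarrow> (cmod (eval_fps (fps_deriv A) z))\<^sup>2 = (cmod (deriv (eval_fps A) z))\<^sup>2"
    proof (intro allI impI)
      fix z :: complex assume "z \<in> ball 0 r"
      hence "ereal (cmod z) < fps_conv_radius A" using r by (auto intro: less_trans[of _ "ereal r"])
      thus "(cmod (eval_fps (fps_deriv A) z))\<^sup>2 = (cmod (deriv (eval_fps A) z))\<^sup>2"
        by (simp add: eval_fps_deriv)
    qed
  qed simp
  finally show ?thesis .
qed

text \<open>The differentiated geometric series with ratio \<open>a\<^sup>2 * r\<^sup>2\<close>. For
  \<open>b = (1 - a\<^sup>2)\<^sup>2\<close> and a < 1 the value is the normalized area of the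
  Moebius map with parameter a.\<close>

lemma extremal_area_series:
  fixes a b r :: real
  assumes "0 \<le> a" "a \<le> 1" "0 \<le> r" "r < 1"
  shows "(\<lambda>n. real (Suc n) * r ^ (2 * Suc n) * (b * (a\<^sup>2) ^ n)) sums (b * r\<^sup>2 / (1 - a\<^sup>2 * r\<^sup>2)\<^sup>2)"
proof -
  have "a\<^sup>2 * r\<^sup>2 \<le> 1 * r\<^sup>2" using assms by (intro mult_right_mono) (auto simp: abs_square_le_1)
  also have "\<dots> < 1" using assms by (simp add: abs_square_less_1)
  finally have "norm (a\<^sup>2 * r\<^sup>2) < 1" by simp
  from sums_mult[OF geometric_deriv_sums[OF this], of "b * r\<^sup>2"]
  have "(\<lambda>n. b * r\<^sup>2 * (real (Suc n) * (a\<^sup>2 * r\<^sup>2) ^ n)) sums (b * r\<^sup>2 / (1 - a\<^sup>2 * r\<^sup>2)\<^sup>2)" by simp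
  moreover have "b * r\<^sup>2 * (real (Suc n) * (a\<^sup>2 * r\<^sup>2) ^ n) = real (Suc n) * r ^ (2 * Suc n) * (b * (a\<^sup>2) ^ n)" for n
    unfolding power_mult power_mult_distrib by (simp add: mult_ac)
  ultimately show ?thesis by (simp only:)
qed

section \<open>Carlson's coefficient inequalities\<close>

lemma fps_conv_radius_finite_support:
  fixes G :: "complex fps"
  assumes "\<And>j. m < j \<Longrightarrow> fps_nth G j = 0"
  shows "fps_conv_radius G = \<infinity>"
proof -
  have "conv_radius (fps_nth G) = conv_radius (\<lambda>_. 0 :: complex)"
    by (intro conv_radius_cong eventually_mono[OF eventually_gt_at_top[of m]]) (simp add: assms)
  thus ?thesis by (simp add: fps_conv_radius_def)
qed

text \<open>Consecutive partial sums differ by \<open>c j\<close>, so multiplying their generating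
  function by 1 - x leaves that of c, shifted by one power. This evaluates the partial sums that
  occur in Carlson's bounds.\<close>

lemma partial_sum_series:
  fixes c :: "nat \<Rightarrow> real"
  assumes c: "\<And>n. 0 \<le> c n" "\<And>n. (\<Sum>i<n. c i) \<le> C" and x: "0 \<le> x" "x < 1"
  shows "summable (\<lambda>j. c j * x ^ Suc j)"
    and "(\<lambda>j. (\<Sum>i<j. c i) * x ^ j) sums ((\<Sum>j. c j * x ^ Suc j) / (1 - x))"
proof -
  let ?B = "\<lambda>j. \<Sum>i<j. c i"
  have B0: "0 \<le> ?B j" for j using c by (simp add: sum_nonneg)
  have cC: "c j \<le> C" for j
    using B0[of j] c(2)[of "Suc j"] by simp
  have geo: "summable (\<lambda>j. C * x ^ j)" using x by (intro summable_mult summable_geometric) auto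
  have sB: "summable (\<lambda>j. ?B j * x ^ j)"
    by (rule summable_comparison_test'[OF geo, of 0])
       (use B0 c x in \<open>auto simp: abs_mult intro!: mult_right_mono\<close>)
  have "summable (\<lambda>j. C * x ^ j * x)" using geo by (rule summable_mult2)
  thus sc: "summable (\<lambda>j. c j * x ^ Suc j)"
  proof (rule summable_comparison_test'[of _ 0])
    fix j
    have "c j * x ^ Suc j \<le> C * x ^ Suc j" using cC x by (intro mult_right_mono) auto
    thus "norm (c j * x ^ Suc j) \<le> C * x ^ j * x" using c(1)[of j] x by (simp add: abs_mult mult_ac)
  qed
  have "(\<Sum>j. ?B j * x ^ j) = (\<Sum>j. ?B (Suc j) * x ^ Suc j)"
    using suminf_split_head[OF sB] by simp
  also have "\<dots> = (\<Sum>j. x * (?B j * x ^ j) + c j * x ^ Suc j)"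
    by (simp add: algebra_simps)
  also have "\<dots> = x * (\<Sum>j. ?B j * x ^ j) + (\<Sum>j. c j * x ^ Suc j)"
    using sB sc by (subst suminf_add[symmetric]) (auto simp: suminf_mult intro: summable_mult)
  finally have "(\<Sum>j. ?B j * x ^ j) * (1 - x) = (\<Sum>j. c j * x ^ Suc j)"
    by (simp add: algebra_simps)
  hence "(\<Sum>j. ?B j * x ^ j) = (\<Sum>j. c j * x ^ Suc j) / (1 - x)"
    using x by (simp add: eq_divide_eq)
  thus "(\<lambda>j. ?B j * x ^ j) sums ((\<Sum>j. c j * x ^ Suc j) / (1 - x))"
    using summable_sums[OF sB] by simp
qed

text \<open>Summation by parts, done as an induction on a stronger claim: the last weight times the
  partial sum of d bounds the weighted sum from below.\<close>

lemma weighted_sum_nonneg: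
  fixes w d :: "nat \<Rightarrow> real"
  assumes d: "\<And>n. 0 \<le> (\<Sum>i<n. d i)" and w: "\<And>n. w (Suc n) \<le> w n" "\<And>n. 0 \<le> w n"
  shows "0 \<le> (\<Sum>i<n. w i * d i)"
proof -
  have "w n * (\<Sum>i<Suc n. d i) \<le> (\<Sum>i<Suc n. w i * d i)" for n
  proof (induction n)
    case (Suc n)
    have "w (Suc n) * (\<Sum>i<Suc (Suc n). d i) = w (Suc n) * (\<Sum>i<Suc n. d i) + w (Suc n) * d (Suc n)"
      by (simp add: algebra_simps)
    also have "\<dots> \<le> w n * (\<Sum>i<Suc n. d i) + w (Suc n) * d (Suc n)"
      using mult_right_mono[OF w(1) d[of "Suc n"]] by (intro add_right_mono)
    also have "\<dots> \<le> (\<Sum>i<Suc n. w i * d i) + w (Suc n) * d (Suc n)"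
      using Suc.IH by (intro add_right_mono)
    finally show ?case by simp
  qed simp
  moreover have "0 \<le> w n * (\<Sum>i<Suc n. d i)" for n
    using w(2) d[of "Suc n"] by (intro mult_nonneg_nonneg)
  ultimately show ?thesis by (cases n) (auto intro: order_trans simp del: sum.lessThan_Suc)
qed

text \<open>The parameter w is free. For s < 1 the choice w = y / (1 - s) turns y + w s into w
  itself, and the hypothesis becomes (1 - s) |w|^2 <= 1 - s.\<close>

lemma norm_le_one_minus:
  fixes y :: complex
  assumes s: "0 \<le> s" and *: "\<And>w. s + (cmod (y + w * of_real s))\<^sup>2 \<le> 1 + (cmod w)\<^sup>2 * s"
  shows "cmod y \<le> 1 - s"
proof (cases "s < 1")
  case True
  define d where "d = 1 - s"
  have d: "d > 0" "s = 1 - d" using True by (auto simp: d_def)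
  have of_real_s: "complex_of_real s = 1 - of_real d" using d(2) by simp
  have "y + y / of_real d * of_real s = y / of_real d"
    unfolding of_real_s using d(1) by (simp add: field_simps)
  hence "s + (cmod y / d)\<^sup>2 \<le> 1 + (cmod y / d)\<^sup>2 * s"
    using *[of "y / of_real d"] d by (simp add: norm_divide)
  hence "d * (cmod y / d)\<^sup>2 \<le> d * 1" using d by (simp add: algebra_simps)
  hence "(cmod y / d)\<^sup>2 \<le> 1\<^sup>2" using d(1) by (subst (asm) mult_le_cancel_left_pos) auto
  hence "cmod y / d \<le> 1" by (rule power2_le_imp_le) simp
  thus ?thesis using d(1) unfolding d_def[symmetric] by simp
next
  case False
  \<comment> \<open>Here w = 0 forces s = 1, and then w = y forces y = 0.\<close>
  have "s + (cmod y)\<^sup>2 \<le> 1" using *[of 0] by simp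
  hence "s \<le> 1" using zero_le_power2[of "cmod y"] by linarith
  hence s1: "s = 1" using False by simp
  have "(cmod (2 * y))\<^sup>2 \<le> (cmod y)\<^sup>2" using *[of y] by (simp add: s1)
  thus ?thesis by (simp add: s1 norm_mult power_mult_distrib)
qed

text \<open>
  Supplies the phase that aligns \<open>a_n^2 / (\<omega> - a_0)\<close>, \<open>|\<omega>| = 1\<close>, with \<open>a_(2n)\<close>.
\<close>

lemma ray_meets_unit_circle:
  assumes "cmod a < 1" "cmod u = 1"
  obtains \<rho> where "0 < \<rho>" "\<rho> \<le> 1 + cmod a" "cmod (a + of_real \<rho> * u) = 1"
proof -
  \<comment> \<open>At \<rho> = 0 the modulus is |a| < 1; at \<rho> = 2 it is at least 2 - |a| >
    1.\<close>
  have "\<exists>\<rho>. 0 \<le> \<rho> \<and> \<rho> \<le> 2 \<and> cmod (a + of_real \<rho> * u) = 1"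
  proof (rule IVT')
    show "cmod (a + of_real 0 * u) \<le> 1" using assms by simp
    have "2 = cmod (a + of_real 2 * u - a)" using assms by (simp add: norm_mult)
    also have "\<dots> \<le> cmod (a + of_real 2 * u) + cmod a" by (rule norm_triangle_ineq4)
    finally show "1 \<le> cmod (a + of_real 2 * u)" using assms by simp
  qed (auto intro!: continuous_intros)
  then obtain \<rho> where \<rho>: "0 \<le> \<rho>" "cmod (a + of_real \<rho> * u) = 1" by blast
  have "\<rho> = cmod (a + of_real \<rho> * u - a)" using \<rho> assms by (simp add: norm_mult)
  also have "\<dots> \<le> cmod (a + of_real \<rho> * u) + cmod a" by (rule norm_triangle_ineq4)
  finally have "\<rho> \<le> 1 + cmod a" using \<rho> by simp
  moreover have "0 < \<rho>" using \<rho> assms by (cases "\<rho> = 0") auto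
  ultimately show ?thesis using that \<rho>(2) by blast
qed

section \<open>Contractivity of multiplication by a bounded function\<close>

lemma
  assumes "f holomorphic_on ball 0 1" "\<And>z. cmod z < 1 \<Longrightarrow> cmod (f z) \<le> 1"
  shows radius_fps_expansion: "1 \<le> fps_conv_radius (fps_expansion f 0)"
    and bounded_fps_expansion: "\<And>z. cmod z < 1 \<Longrightarrow> cmod (eval_fps (fps_expansion f 0) z) \<le> 1"
proof -
  have holo: "f holomorphic_on eball 0 1" using assms(1) by (metis eball_ereal one_ereal_def)
  show "1 \<le> fps_conv_radius (fps_expansion f 0)" by (rule conv_radius_fps_expansion[OF holo])
  show "cmod (eval_fps (fps_expansion f 0) z) \<le> 1" if "cmod z < 1" for z
    using assms(2)[OF that] eval_fps_expansion'[OF holo, of z] that by simp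
qed

text \<open>As |A| <= 1 on the disc, |G A| <= |G| holds pointwise;
  \<open>coefficient_norm_mono\<close> transfers this to square sums of coefficients.\<close>

lemma coefficient_multiplier:
  fixes A G :: "complex fps"
  assumes radius: "1 \<le> fps_conv_radius A"
    and bounded: "\<And>z. cmod z < 1 \<Longrightarrow> cmod (eval_fps A z) \<le> 1"
    and G: "\<And>j. m < j \<Longrightarrow> fps_nth G j = 0"
  shows "(\<Sum>i<N. (cmod (fps_nth (G * A) i))\<^sup>2) \<le> (\<Sum>j\<le>m. (cmod (fps_nth G j))\<^sup>2)"
proof (rule coefficient_norm_mono)
  have rG: "fps_conv_radius G = \<infinity>" by (rule fps_conv_radius_finite_support[OF G])
  show "1 \<le> fps_conv_radius G" by (simp add: rG)
  show "1 \<le> fps_conv_radius (G * A)"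
    using fps_conv_radius_mult[of G A] radius by (simp add: rG)
  show "cmod (eval_fps (G * A) z) \<le> cmod (eval_fps G z)" if "cmod z < 1" for z
  proof -
    have "ereal (cmod z) < fps_conv_radius A"
      using that radius by (metis ereal_less(3) less_le_trans)
    hence "eval_fps (G * A) z = eval_fps G z * eval_fps A z"
      by (subst eval_fps_mult) (auto simp: rG)
    thus ?thesis using bounded[OF that] by (simp add: norm_mult mult_left_le)
  qed
  show "(\<Sum>k<n. (cmod (fps_nth G k))\<^sup>2) \<le> (\<Sum>j\<le>m. (cmod (fps_nth G j))\<^sup>2)" for n
  proof -
    have "(\<Sum>k<n. (cmod (fps_nth G k))\<^sup>2) = (\<Sum>k\<in>{..<n} \<inter> {..m}. (cmod (fps_nth G k))\<^sup>2)"
      by (intro sum.mono_neutral_right) (auto intro!: leI dest: G)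
    also have "\<dots> \<le> (\<Sum>j\<le>m. (cmod (fps_nth G j))\<^sup>2)"
      by (intro sum_mono2) auto
    finally show ?thesis .
  qed
qed

abbreviation center_norm :: "complex fps \<Rightarrow> real" where
  "center_norm A \<equiv> cmod (fps_nth A 0)"

abbreviation tail_square :: "complex fps \<Rightarrow> nat \<Rightarrow> real" where
  "tail_square A n \<equiv> (cmod (fps_nth A (Suc n)))\<^sup>2"

context
  fixes A :: "complex fps"
  assumes radius: "1 \<le> fps_conv_radius A"
    and bounded: "\<And>z. cmod z < 1 \<Longrightarrow> cmod (eval_fps A z) \<le> 1"
begin

text \<open>
  The test polynomial is \<open>q\<close> (degree at most \<open>m - k\<close>) plus \<open>w\<close> times the reflected conjugates of the first
  \<open>k\<close> coefficients of \<open>A\<close>, placed at degrees \<open>m - k + 1, ..., m\<close>, so that only the \<open>m\<close>-th coefficient of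
  the product, among those retained, depends on \<open>w\<close>.
\<close>

lemma coefficient_form_bound:
  fixes q :: "nat \<Rightarrow> complex"
  assumes k: "1 \<le> k" "k \<le> m"
  defines "s \<equiv> \<Sum>i<k. (cmod (fps_nth A i))\<^sup>2"
  shows "(\<Sum>i\<le>m - k. (cmod (\<Sum>j\<le>i. q j * fps_nth A (i - j)))\<^sup>2)
      + (cmod ((\<Sum>j\<le>m - k. q j * fps_nth A (m - j)) + w * of_real s))\<^sup>2
    \<le> (\<Sum>j\<le>m - k. (cmod (q j))\<^sup>2) + (cmod w)\<^sup>2 * s"
proof -
  define G where "G = Abs_fps (\<lambda>j. if j \<le> m - k then q j else if j \<le> m then w * cnj (fps_nth A (m - j)) else 0)"
  have split: "{..m} = {..m - k} \<union> {m - k<..m}" using k by auto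
  have sum_split: "(\<Sum>j\<le>m. h j) = (\<Sum>j\<le>m - k. h j) + (\<Sum>j\<in>{m - k<..m}. h j)"
    for h :: "nat \<Rightarrow> 'x :: comm_monoid_add"
    unfolding split by (rule sum.union_disjoint) auto
  have reflect: "(\<Sum>j\<in>{m - k<..m}. h (m - j)) = (\<Sum>i<k. h i)" for h :: "nat \<Rightarrow> 'x :: comm_monoid_add"
    by (rule sum.reindex_bij_witness[of _ "\<lambda>i. m - i" "\<lambda>j. m - j"]) (use k in auto)
  have low: "fps_nth (G * A) i = (\<Sum>j\<le>i. q j * fps_nth A (i - j))" if "i \<le> m - k" for i
    unfolding fps_mult_nth atMost_atLeast0 using that by (intro sum.cong) (auto simp: G_def)
  have "fps_nth (G * A) m = (\<Sum>j\<le>m. fps_nth G j * fps_nth A (m - j))"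
    by (simp add: fps_mult_nth atMost_atLeast0)
  also have "\<dots> = (\<Sum>j\<le>m - k. q j * fps_nth A (m - j))
      + (\<Sum>j\<in>{m - k<..m}. w * (cnj (fps_nth A (m - j)) * fps_nth A (m - j)))"
    unfolding sum_split by (intro arg_cong2[where f = "(+)"] sum.cong) (auto simp: G_def)
  also have "(\<Sum>j\<in>{m - k<..m}. w * (cnj (fps_nth A (m - j)) * fps_nth A (m - j))) = w * of_real s"
    unfolding reflect[of "\<lambda>i. w * (cnj (fps_nth A i) * fps_nth A i)"] s_def of_real_sum
      complex_norm_square sum_distrib_left by (simp add: mult.commute)
  finally have top: "fps_nth (G * A) m = (\<Sum>j\<le>m - k. q j * fps_nth A (m - j)) + w * of_real s" .
  \<comment> \<open>As k >= 1, the index m lies outside \<open>{..m - k}\<close>; the coefficients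
    strictly between are discarded.\<close>
  have "(\<Sum>i\<le>m - k. (cmod (\<Sum>j\<le>i. q j * fps_nth A (i - j)))\<^sup>2)
      + (cmod ((\<Sum>j\<le>m - k. q j * fps_nth A (m - j)) + w * of_real s))\<^sup>2
    = (\<Sum>i\<in>insert m {..m - k}. (cmod (fps_nth (G * A) i))\<^sup>2)"
    using k by (subst sum.insert) (auto simp: low top)
  also have "\<dots> \<le> (\<Sum>i<Suc m. (cmod (fps_nth (G * A) i))\<^sup>2)"
    by (intro sum_mono2) auto
  also have "\<dots> \<le> (\<Sum>j\<le>m. (cmod (fps_nth G j))\<^sup>2)"
    by (rule coefficient_multiplier[OF radius bounded]) (simp_all add: G_def)
  also have "\<dots> = (\<Sum>j\<le>m - k. (cmod (q j))\<^sup>2) + (\<Sum>j\<in>{m - k<..m}. (cmod w)\<^sup>2 * (cmod (fps_nth A (m - j)))\<^sup>2)"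
    unfolding sum_split
    by (intro arg_cong2[where f = "(+)"] sum.cong) (auto simp: G_def norm_mult power_mult_distrib)
  also have "(\<Sum>j\<in>{m - k<..m}. (cmod w)\<^sup>2 * (cmod (fps_nth A (m - j)))\<^sup>2) = (cmod w)\<^sup>2 * s"
    by (subst reflect[of "\<lambda>i. (cmod w)\<^sup>2 * (cmod (fps_nth A i))\<^sup>2"]) (simp add: s_def sum_distrib_left)
  finally show ?thesis .
qed

text \<open>Test with the constant polynomial 1.\<close>

lemma coefficient_square_sum_le: "(\<Sum>i<N. (cmod (fps_nth A i))\<^sup>2) \<le> 1"
  using coefficient_multiplier[OF radius bounded, of 0 1 N] by simp

text \<open>Test with q = 1, m = 2n + 1, k = n + 1: the retained low coefficients a_0, ..., a_n have
  the same square sum s that multiplies w at index m, which is the shape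
  \<open>norm_le_one_minus\<close> exploits.\<close>

lemma odd_coefficient_bound:
  "cmod (fps_nth A (2 * n + 1)) \<le> 1 - (\<Sum>i\<le>n. (cmod (fps_nth A i))\<^sup>2)"
proof (rule norm_le_one_minus)
  fix w
  let ?q = "\<lambda>j. if j = 0 then 1 else 0 :: complex"
  have q: "(\<Sum>j\<le>i. ?q j * h j) = h 0" for h and i :: nat
    by (simp add: if_distrib[of "\<lambda>x. x * _"] cong: if_cong)
  have q2: "(\<Sum>j\<le>i. (cmod (?q j))\<^sup>2) = 1" for i :: nat
    by (simp add: if_distrib[of "\<lambda>x. (cmod x)\<^sup>2"] cong: if_cong)
  have "2 * n + 1 - Suc n = n" by simp
  with coefficient_form_bound[of "Suc n" "2 * n + 1" ?q w]
  show "(\<Sum>i\<le>n. (cmod (fps_nth A i))\<^sup>2)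
      + (cmod (fps_nth A (2 * n + 1) + w * complex_of_real (\<Sum>i\<le>n. (cmod (fps_nth A i))\<^sup>2)))\<^sup>2
    \<le> 1 + (cmod w)\<^sup>2 * (\<Sum>i\<le>n. (cmod (fps_nth A i))\<^sup>2)"
    unfolding q q2 lessThan_Suc_atMost diff_zero by simp
qed (simp add: sum_nonneg)

text \<open>Test with q = 1 + c z^n, m = 2n, k = n. The hypothesis on c gives the n-th coefficient
  a_n + c a_0 of the product the modulus |c|, which cancels the extra |c|^2 in the norm of
  q.\<close>

lemma even_coefficient_circle_bound:
  assumes n: "1 \<le> n" and c: "cmod (fps_nth A n + c * fps_nth A 0) = cmod c"
  shows "cmod (fps_nth A (2 * n) + c * fps_nth A n) \<le> 1 - (\<Sum>i<n. (cmod (fps_nth A i))\<^sup>2)"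
proof (rule norm_le_one_minus)
  fix w
  let ?q = "\<lambda>j. if j = 0 then 1 else if j = n then c else 0"
  have q: "(\<Sum>j\<le>i. ?q j * h j) = h 0 + (if n \<le> i then c * h n else 0)" for h :: "nat \<Rightarrow> complex" and i
  proof -
    have "(\<Sum>j\<le>i. ?q j * h j) = (\<Sum>j\<le>i. (if j = 0 then h j else 0) + (if j = n then c * h j else 0))"
      using n by (intro sum.cong) auto
    thus ?thesis by (simp add: sum.distrib)
  qed
  have q2: "(\<Sum>j\<le>n. (cmod (?q j))\<^sup>2) = 1 + (cmod c)\<^sup>2"
  proof -
    have "(\<Sum>j\<le>n. (cmod (?q j))\<^sup>2) = (\<Sum>j\<le>n. (if j = 0 then 1 else 0) + (if j = n then (cmod c)\<^sup>2 else 0))"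
      using n by (intro sum.cong) auto
    thus ?thesis by (simp add: sum.distrib)
  qed
  let ?s = "\<Sum>i<n. (cmod (fps_nth A i))\<^sup>2"
  have top: "(\<Sum>i\<le>n. h i) = (\<Sum>i<n. h i) + h n" for h :: "nat \<Rightarrow> real"
    by (simp flip: lessThan_Suc_atMost)
  have conv: "(\<Sum>j\<le>i. ?q j * fps_nth A (i - j)) = fps_nth A i + (if n \<le> i then c * fps_nth A (i - n) else 0)" for i
    using q[where i = i and h = "\<lambda>j. fps_nth A (i - j)"] unfolding diff_zero .
  have s1: "(\<Sum>i<n. (cmod (\<Sum>j\<le>i. ?q j * fps_nth A (i - j)))\<^sup>2) = ?s"
  proof (rule sum.cong)
    fix i assume "i \<in> {..<n}"
    hence "\<not> n \<le> i" by simp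
    thus "(cmod (\<Sum>j\<le>i. ?q j * fps_nth A (i - j)))\<^sup>2 = (cmod (fps_nth A i))\<^sup>2"
      unfolding conv by (simp only: if_False add_0_right)
  qed (rule refl)
  have s2: "(\<Sum>j\<le>n. ?q j * fps_nth A (n - j)) = fps_nth A n + c * fps_nth A 0"
    unfolding conv by (simp only: order_refl if_True diff_self_eq_0)
  have B: "(\<Sum>i\<le>n. (cmod (\<Sum>j\<le>i. ?q j * fps_nth A (i - j)))\<^sup>2) = ?s + (cmod c)\<^sup>2"
    by (rule top[THEN trans], rule arg_cong2[where f = "(+)"], rule s1, subst s2, subst c, rule refl)
  have y: "(\<Sum>j\<le>n. ?q j * fps_nth A (2 * n - j)) = fps_nth A (2 * n) + c * fps_nth A n"
    using q[where i = n and h = "\<lambda>j. fps_nth A (2 * n - j)"] by (simp only: order_refl if_True diff_zero) (simp add: mult_2)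
  have m: "2 * n - n = n" and le: "n \<le> 2 * n" by simp_all
  have "?s + (cmod c)\<^sup>2 + (cmod (fps_nth A (2 * n) + c * fps_nth A n + w * complex_of_real ?s))\<^sup>2
      \<le> 1 + (cmod c)\<^sup>2 + (cmod w)\<^sup>2 * ?s"
    using coefficient_form_bound[of n "2 * n" ?q w, OF n le] unfolding m B y q2 .
  thus "?s + (cmod (fps_nth A (2 * n) + c * fps_nth A n + w * complex_of_real ?s))\<^sup>2
      \<le> 1 + (cmod w)\<^sup>2 * ?s" by simp
qed (simp add: sum_nonneg)

text \<open>The multiplier c is chosen to satisfy the modulus condition and to put c a_n in phase
  with a_(2n), so that the two moduli add; here |c a_n| = |a_n|^2 / \<rho> with \<rho> <= 1 +
  |a_0|.\<close>

lemma even_coefficient_bound: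
  assumes n: "1 \<le> n" and a: "cmod (fps_nth A 0) < 1"
  shows "cmod (fps_nth A (2 * n)) \<le>
    1 - (\<Sum>i<n. (cmod (fps_nth A i))\<^sup>2) - (cmod (fps_nth A n))\<^sup>2 / (1 + cmod (fps_nth A 0))"
proof (cases "fps_nth A n = 0")
  case True
  thus ?thesis using even_coefficient_circle_bound[OF n, of 0] by simp
next
  case False
  let ?a = "fps_nth A 0" and ?b = "fps_nth A n" and ?x = "fps_nth A (2 * n)"
  \<comment> \<open>The phase of a_(2n); the default 1 keeps \<open>v\<close> unimodular when that
    coefficient vanishes.\<close>
  define v where "v = (if ?x = 0 then 1 else sgn ?x)"
  have v: "cmod v = 1" "?x = of_real (cmod ?x) * v"
    by (auto simp: v_def norm_divide sgn_eq)
  \<comment> \<open>This phase makes \<open>?b\<^sup>2 / u\<close> a positive multiple of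
    \<open>v\<close>.\<close>
  define u where "u = (sgn ?b)\<^sup>2 / v"
  have u: "cmod u = 1" using False v by (simp add: u_def norm_divide norm_power norm_sgn)
  obtain \<rho> where \<rho>: "0 < \<rho>" "\<rho> \<le> 1 + cmod ?a" "cmod (?a + of_real \<rho> * u) = 1"
    using ray_meets_unit_circle[OF a u] .
  \<comment> \<open>Then a_n + c a_0 = c (a_0 + \<rho> u), whose second factor is
    unimodular.\<close>
  define c where "c = ?b / (of_real \<rho> * u)"
  have v0: "v \<noteq> 0" and u0: "u \<noteq> 0" using v u by auto
  have "?b + c * ?a = c * (?a + of_real \<rho> * u)"
    using \<rho> u0 by (simp add: c_def field_simps)
  hence "cmod (?b + c * ?a) = cmod c" using \<rho> by (simp add: norm_mult)
  hence le: "cmod (?x + c * ?b) \<le> 1 - (\<Sum>i<n. (cmod (fps_nth A i))\<^sup>2)"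
    by (rule even_coefficient_circle_bound[OF n])
  have b: "?b = of_real (cmod ?b) * sgn ?b"
    by (simp add: sgn_eq)
  have "c * ?b = ?b\<^sup>2 / (of_real \<rho> * u)" by (simp add: c_def power2_eq_square)
  also have "?b\<^sup>2 = of_real ((cmod ?b)\<^sup>2) * (u * v)"
    by (subst b) (simp add: u_def v0 power_mult_distrib)
  also have "\<dots> / (of_real \<rho> * u) = of_real ((cmod ?b)\<^sup>2 / \<rho>) * v"
    using u0 by simp
  finally have "?x + c * ?b = of_real (cmod ?x + (cmod ?b)\<^sup>2 / \<rho>) * v"
    by (subst v(2)) (simp add: algebra_simps)
  hence "cmod (?x + c * ?b) = cmod ?x + (cmod ?b)\<^sup>2 / \<rho>"
    using v \<rho> by (simp only: norm_mult norm_of_real) simp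
  moreover have "(cmod ?b)\<^sup>2 / (1 + cmod ?a) \<le> (cmod ?b)\<^sup>2 / \<rho>"
    using \<rho> by (intro divide_left_mono mult_pos_pos) (auto intro: add_pos_nonneg)
  ultimately show ?thesis using le by linarith
qed

section \<open>Consequences of the Schwarz lemma\<close>

lemma norm_less_radius: "cmod z < 1 \<Longrightarrow> ereal (cmod z) < fps_conv_radius A"
  using radius by (metis ereal_less(3) less_le_trans)

lemma holomorphic_eval_fps: "eval_fps A holomorphic_on ball 0 1"
  by (intro holomorphic_on_eval_fps) (auto simp: norm_less_radius)

lemma norm_coefficient_0_le: "center_norm A \<le> 1"
proof -
  have "(center_norm A)\<^sup>2 \<le> 1" using coefficient_square_sum_le[of 1] by simp
  thus ?thesis by (simp add: abs_square_le_1)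
qed

lemma tail_square_sum_le: "(\<Sum>i<n. tail_square A i) \<le> 1 - (center_norm A)\<^sup>2"
  using coefficient_square_sum_le[of "Suc n"]
  by (simp add: sum.lessThan_Suc_shift del: sum.lessThan_Suc)

text \<open>The coefficient a_0 alone exhausts the bound 1 on the square sum.\<close>

lemma constant_if_norm_coefficient_0_eq_1:
  assumes "center_norm A = 1"
  shows "A = fps_const (fps_nth A 0)"
proof (rule fps_ext)
  fix n
  show "fps_nth A n = fps_nth (fps_const (fps_nth A 0)) n"
  proof (cases n)
    case (Suc m)
    have "tail_square A m \<le> (\<Sum>i<Suc m. tail_square A i)" by (simp add: sum_nonneg)
    also have "\<dots> \<le> 0" using tail_square_sum_le[of "Suc m"] assms by simp
    finally have "tail_square A m = 0" by (simp add: antisym)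
    thus ?thesis using Suc by simp
  qed simp
qed

text \<open>The Moebius transform \<phi> of f that sends a_0 to 0 fixes the origin and maps the disc
  into itself, so Schwarz's lemma gives \<phi> = z h. Clearing the denominator yields an identity of
  power series, usable both pointwise and on coefficients.\<close>

lemma schwarz_quotient:
  obtains H where "1 \<le> fps_conv_radius H" "\<And>z. cmod z < 1 \<Longrightarrow> cmod (eval_fps H z) \<le> 1"
    "A - fps_const (fps_nth A 0) = fps_X * ((1 - fps_const (cnj (fps_nth A 0)) * A) * H)"
proof (cases "center_norm A = 1")
  case True
  have "A - fps_const (fps_nth A 0) = 0"
    using constant_if_norm_coefficient_0_eq_1[OF True] by simp
  thus ?thesis using that[of 0] by simp
next
  case False
  hence a1: "center_norm A < 1" using norm_coefficient_0_le by simp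
  let ?f = "eval_fps A" and ?b = "fps_nth A 0"
  \<comment> \<open>If modulus 1 were attained inside, the maximum principle would make f constant,
    against |a_0| < 1.\<close>
  have strict: "cmod (?f z) < 1" if z: "cmod z < 1" for z
  proof (rule ccontr)
    assume "\<not> cmod (?f z) < 1"
    hence eq: "cmod (?f z) = 1" using bounded[OF z] by simp
    have "?f constant_on ball 0 1"
      by (rule maximum_modulus_principle[OF holomorphic_eval_fps, of "ball 0 1" z])
         (use z eq bounded in auto)
    then obtain w where "\<And>x. x \<in> ball 0 1 \<Longrightarrow> ?f x = w" unfolding constant_on_def by blast
    hence "?f z = ?f 0" using z by simp
    thus False using eq a1 by (simp add: eval_fps_at_0)
  qed
  have denom: "1 - cnj ?b * ?f z \<noteq> 0" if "cmod z < 1" for z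
  proof
    assume "1 - cnj ?b * ?f z = 0"
    hence "cmod (cnj ?b * ?f z) = 1" by (metis eq_iff_diff_eq_0 norm_one)
    moreover have "center_norm A * cmod (?f z) < 1"
      using mult_le_one[of "center_norm A" "cmod (?f z)"] a1 strict[OF that]
      by (smt (verit) mult_left_le norm_ge_zero)
    ultimately show False by (simp add: norm_mult)
  qed
  define \<phi> where "\<phi> z = (?f z - ?b) / (1 - cnj ?b * ?f z)" for z
  have "\<phi> holomorphic_on ball 0 1"
    unfolding \<phi>_def using denom by (intro holomorphic_intros holomorphic_eval_fps) auto
  moreover have \<phi>0: "\<phi> 0 = 0" by (simp add: \<phi>_def eval_fps_at_0)
  moreover have "cmod (\<phi> z) < 1" if "cmod z < 1" for z
  proof -
    let ?w = "?f z"
    \<comment> \<open>Both factors on the right are positive, so this identity gives |\<phi>| <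
      1.\<close>
    have id: "(cmod (1 - cnj ?b * ?w))\<^sup>2 - (cmod (?w - ?b))\<^sup>2 = (1 - (center_norm A)\<^sup>2) * (1 - (cmod ?w)\<^sup>2)"
      by (simp only: cmod_power2 complex_cnj minus_complex.simps times_complex.simps one_complex.simps
          cnj.simps) (simp add: algebra_simps power2_eq_square)
    have "0 < (1 - (center_norm A)\<^sup>2) * (1 - (cmod ?w)\<^sup>2)"
      using a1 strict[OF that] by (intro mult_pos_pos) (simp_all add: abs_square_less_1)
    hence "(cmod (?w - ?b))\<^sup>2 < (cmod (1 - cnj ?b * ?w))\<^sup>2" using id by linarith
    hence "cmod (?w - ?b) < cmod (1 - cnj ?b * ?w)" by (rule power2_less_imp_less) simp
    thus ?thesis using denom[OF that] by (simp add: \<phi>_def norm_divide)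
  qed
  ultimately have S: "cmod (\<phi> z) \<le> cmod z" "cmod (deriv \<phi> 0) \<le> 1" if "cmod z < 1" for z
    using Schwarz_Lemma[of \<phi> z] that by auto
  obtain h where h: "h holomorphic_on ball 0 1" "\<And>z. cmod z < 1 \<Longrightarrow> \<phi> z = z * h z" "deriv \<phi> 0 = h 0"
    using Schwarz3[OF \<open>\<phi> holomorphic_on ball 0 1\<close> \<phi>0] by blast
  have hle: "cmod (h z) \<le> 1" if "cmod z < 1" for z
  proof (cases "z = 0")
    case True
    thus ?thesis using S(2)[of 0] h(3) by simp
  next
    case False
    have "cmod z * cmod (h z) \<le> cmod z * 1" using S(1)[OF that] h(2)[OF that] by (simp add: norm_mult)
    thus ?thesis using False by (subst (asm) mult_le_cancel_left_pos) auto
  qed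
  define H where "H = fps_expansion h 0"
  have H: "1 \<le> fps_conv_radius H" "\<And>z. cmod z < 1 \<Longrightarrow> cmod (eval_fps H z) \<le> 1"
    unfolding H_def using radius_fps_expansion[OF h(1) hle] bounded_fps_expansion[OF h(1) hle] by blast+
  have "h holomorphic_on eball 0 1" using h(1) by (metis eball_ereal one_ereal_def)
  hence evalH: "eval_fps H z = h z" if "cmod z < 1" for z
    using eval_fps_expansion'[of h 0 1 z] that by (simp add: H_def)
  have "A - fps_const ?b = fps_X * ((1 - fps_const (cnj ?b) * A) * H)"
  proof (rule eval_fps_eqD)
    have r1: "1 \<le> fps_conv_radius (A - fps_const ?b)"
      using fps_conv_radius_diff[of A "fps_const ?b"] radius by simp
    have r2: "1 \<le> fps_conv_radius (fps_const (cnj ?b) * A)"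
      using fps_conv_radius_mult[of "fps_const (cnj ?b)" A] radius by simp
    have r3: "1 \<le> fps_conv_radius (1 - fps_const (cnj ?b) * A)"
      using fps_conv_radius_diff[of 1 "fps_const (cnj ?b) * A"] r2 by simp
    have r4: "1 \<le> fps_conv_radius ((1 - fps_const (cnj ?b) * A) * H)"
      using fps_conv_radius_mult[of "1 - fps_const (cnj ?b) * A" H] r3 H(1) by (meson min.boundedI order_trans)
    have r5: "1 \<le> fps_conv_radius (fps_X * ((1 - fps_const (cnj ?b) * A) * H))"
      using fps_conv_radius_mult[of fps_X "(1 - fps_const (cnj ?b) * A) * H"] r4 by simp
    show "0 < fps_conv_radius (A - fps_const ?b)" using r1 by (rule less_le_trans[rotated]) simp
    show "0 < fps_conv_radius (fps_X * ((1 - fps_const (cnj ?b) * A) * H))"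
      using r5 by (rule less_le_trans[rotated]) simp
    have "eval_fps (A - fps_const ?b) z = eval_fps (fps_X * ((1 - fps_const (cnj ?b) * A) * H)) z"
      if z: "cmod z < 1" for z
    proof -
      have lt: "ereal (cmod z) < R" if "1 \<le> R" for R
        using z that by (metis ereal_less(3) less_le_trans)
      have "eval_fps (fps_X * ((1 - fps_const (cnj ?b) * A) * H)) z = z * ((1 - cnj ?b * ?f z) * h z)"
        using lt[OF radius] lt[OF r2] lt[OF r3] lt[OF r4] lt[OF H(1)]
        by (simp add: eval_fps_mult eval_fps_diff evalH z)
      also have "\<dots> = (1 - cnj ?b * ?f z) * \<phi> z" by (simp add: h(2)[OF z])
      also have "\<dots> = ?f z - ?b" using denom[OF z] by (simp add: \<phi>_def)
      also have "\<dots> = eval_fps (A - fps_const ?b) z"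
        using lt[OF radius] by (simp add: eval_fps_diff)
      finally show ?thesis by simp
    qed
    thus "\<forall>\<^sub>F z in nhds 0. eval_fps (A - fps_const ?b) z = eval_fps (fps_X * ((1 - fps_const (cnj ?b) * A) * H)) z"
      by (intro eventually_nhds_in_open[of "ball 0 1", THEN eventually_mono]) auto
  qed
  with H show ?thesis by (rule that)
qed

text \<open>Rewriting 1 - cnj a_0 f as (1 - |a_0|^2) - cnj a_0 (f - a_0) in the Schwarz identity
  bounds |f - a_0| in terms of itself, with factor |a_0| |z| < 1; solve for it.\<close>

lemma distance_from_center_bound:
  assumes z: "cmod z < 1"
  shows "cmod (eval_fps A z - fps_nth A 0) \<le> cmod z * (1 - (center_norm A)\<^sup>2) / (1 - center_norm A * cmod z)"
proof -
  let ?f = "eval_fps A" and ?b = "fps_nth A 0"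
  obtain H where H: "1 \<le> fps_conv_radius H" "\<And>z. cmod z < 1 \<Longrightarrow> cmod (eval_fps H z) \<le> 1" and
    eq: "A - fps_const ?b = fps_X * ((1 - fps_const (cnj ?b) * A) * H)"
    by (rule schwarz_quotient) blast
  have r2: "1 \<le> fps_conv_radius (fps_const (cnj ?b) * A)"
    using fps_conv_radius_mult[of "fps_const (cnj ?b)" A] radius by simp
  have r3: "1 \<le> fps_conv_radius (1 - fps_const (cnj ?b) * A)"
    using fps_conv_radius_diff[of 1 "fps_const (cnj ?b) * A"] r2 by simp
  have r4: "1 \<le> fps_conv_radius ((1 - fps_const (cnj ?b) * A) * H)"
    using fps_conv_radius_mult[of "1 - fps_const (cnj ?b) * A" H] r3 H(1) by (meson min.boundedI order_trans)
  have lt: "ereal (cmod z) < R" if "1 \<le> R" for R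
    using z that by (metis ereal_less(3) less_le_trans)
  have "?f z - ?b = eval_fps (A - fps_const ?b) z"
    using lt[OF radius] by (simp add: eval_fps_diff)
  also have "\<dots> = z * ((1 - cnj ?b * ?f z) * eval_fps H z)"
    unfolding eq using lt[OF radius] lt[OF r2] lt[OF r3] lt[OF r4] lt[OF H(1)]
    by (simp add: eval_fps_mult eval_fps_diff)
  finally have "cmod (?f z - ?b) = cmod z * (cmod (1 - cnj ?b * ?f z) * cmod (eval_fps H z))"
    by (simp add: norm_mult)
  also have "\<dots> \<le> cmod z * (cmod (1 - cnj ?b * ?f z) * 1)"
    using H(2)[OF z] by (intro mult_left_mono) auto
  also have "1 - cnj ?b * ?f z = of_real (1 - (center_norm A)\<^sup>2) - cnj ?b * (?f z - ?b)"
    unfolding of_real_diff complex_norm_square by (simp add: algebra_simps)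
  also have "cmod z * (cmod \<dots> * 1) \<le> cmod z * (1 - (center_norm A)\<^sup>2 + center_norm A * cmod (?f z - ?b))"
  proof -
    have "0 \<le> 1 - (center_norm A)\<^sup>2" using norm_coefficient_0_le by (simp add: abs_square_le_1)
    hence "cmod (of_real (1 - (center_norm A)\<^sup>2)) = 1 - (center_norm A)\<^sup>2" by (simp only: norm_of_real abs_of_nonneg)
    thus ?thesis
      using norm_triangle_ineq4[of "of_real (1 - (center_norm A)\<^sup>2)" "cnj ?b * (?f z - ?b)"]
      by (intro mult_left_mono) (simp_all only: norm_mult complex_mod_cnj mult_1_right norm_ge_zero)
  qed
  finally have *: "cmod (?f z - ?b) * (1 - center_norm A * cmod z) \<le> cmod z * (1 - (center_norm A)\<^sup>2)"
    by (simp add: algebra_simps)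
  have "center_norm A * cmod z \<le> 1 * cmod z" using norm_coefficient_0_le by (intro mult_right_mono) auto
  hence "0 < 1 - center_norm A * cmod z" using z by simp
  thus ?thesis using * by (simp add: pos_le_divide_eq)
qed

text \<open>The shifted coefficients of A are those of G H with G = 1 - cnj a_0 A, and
  multiplication by H contracts. The coefficients 1 - |a_0|^2 and - cnj a_0 a_(i+1) of G produce the
  two terms.\<close>

lemma tail_square_sum_recursion:
  "(\<Sum>i<Suc n. tail_square A i) \<le> (1 - (center_norm A)\<^sup>2)\<^sup>2 + (center_norm A)\<^sup>2 * (\<Sum>i<n. tail_square A i)"
proof -
  let ?b = "fps_nth A 0"
  obtain H where H: "1 \<le> fps_conv_radius H" "\<And>z. cmod z < 1 \<Longrightarrow> cmod (eval_fps H z) \<le> 1" and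
    eq: "A - fps_const ?b = fps_X * ((1 - fps_const (cnj ?b) * A) * H)"
    by (rule schwarz_quotient) blast
  define G where "G = 1 - fps_const (cnj ?b) * A"
  \<comment> \<open>Product coefficients up to index n involve only those of G up to n; the cutoff
    makes G a polynomial, as \<open>coefficient_multiplier\<close> requires.\<close>
  have "fps_nth A (Suc i) = fps_nth (fps_cutoff (Suc n) G * H) i" if "i < Suc n" for i
  proof -
    have "fps_nth A (Suc i) = fps_nth (A - fps_const ?b) (Suc i)" by simp
    also have "\<dots> = fps_nth (G * H) i" unfolding eq G_def by (simp add: fps_X_mult_nth)
    also have "\<dots> = fps_nth (fps_cutoff (Suc n) G * H) i"
      unfolding fps_mult_nth using that by (intro sum.cong) auto
    finally show ?thesis .
  qed
  hence "(\<Sum>i<Suc n. tail_square A i) = (\<Sum>i<Suc n. (cmod (fps_nth (fps_cutoff (Suc n) G * H) i))\<^sup>2)"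
    by (intro sum.cong) auto
  also have "\<dots> \<le> (\<Sum>j\<le>n. (cmod (fps_nth (fps_cutoff (Suc n) G) j))\<^sup>2)"
    by (rule coefficient_multiplier[OF H]) simp_all
  also have "\<dots> = (\<Sum>j<Suc n. (cmod (fps_nth G j))\<^sup>2)"
    by (simp only: lessThan_Suc_atMost, intro sum.cong) auto
  also have "\<dots> = (cmod (fps_nth G 0))\<^sup>2 + (center_norm A)\<^sup>2 * (\<Sum>i<n. tail_square A i)"
    by (simp only: sum.lessThan_Suc_shift sum_distrib_left)
       (simp add: G_def norm_mult power_mult_distrib)
  also have "fps_nth G 0 = of_real (1 - (center_norm A)\<^sup>2)"
    unfolding G_def of_real_diff complex_norm_square by (simp add: mult.commute)
  also have "(cmod \<dots>)\<^sup>2 = (1 - (center_norm A)\<^sup>2)\<^sup>2" by (simp only: norm_of_real power2_abs)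
  finally show ?thesis .
qed

text \<open>Iterate the recursion. For |a_0| < 1 the terms on the right are the squared coefficients
  of the Moebius map with parameter |a_0|.\<close>

lemma tail_square_sum_bound: "(\<Sum>i<n. tail_square A i) \<le> (\<Sum>i<n. (1 - (center_norm A)\<^sup>2)\<^sup>2 * ((center_norm A)\<^sup>2) ^ i)"
proof (induction n)
  case (Suc n)
  have "(\<Sum>i<Suc n. tail_square A i) \<le> (1 - (center_norm A)\<^sup>2)\<^sup>2 + (center_norm A)\<^sup>2 * (\<Sum>i<n. tail_square A i)"
    by (rule tail_square_sum_recursion)
  also have "\<dots> \<le> (1 - (center_norm A)\<^sup>2)\<^sup>2 + (center_norm A)\<^sup>2 * (\<Sum>i<n. (1 - (center_norm A)\<^sup>2)\<^sup>2 * ((center_norm A)\<^sup>2) ^ i)"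
    using Suc.IH by (intro add_left_mono mult_left_mono) auto
  also have "\<dots> = (\<Sum>i<Suc n. (1 - (center_norm A)\<^sup>2)\<^sup>2 * ((center_norm A)\<^sup>2) ^ i)"
    by (simp only: sum.lessThan_Suc_shift sum_distrib_left) (simp add: mult_ac)
  finally show ?case .
qed simp

section \<open>Bounds for the series and the area\<close>

text \<open>Carlson's bounds at the indices 2j + 1 and 2j + 2 involve the same partial sum, so
  pairing the terms leaves a series in r^2 that \<open>partial_sum_series\<close> evaluates.\<close>

lemma coefficient_pair_bound:
  assumes a1: "center_norm A < 1" and r: "0 \<le> r"
  shows "cmod (fps_nth A (Suc (2 * j))) * r ^ Suc (2 * j) + cmod (fps_nth A (Suc (Suc (2 * j)))) * r ^ Suc (Suc (2 * j))
    \<le> (1 - (center_norm A)\<^sup>2) * (r ^ Suc (2 * j) + r ^ Suc (Suc (2 * j)))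
      - ((r + r\<^sup>2) * ((\<Sum>i<j. tail_square A i) * (r\<^sup>2) ^ j) + tail_square A j * (r\<^sup>2) ^ Suc j / (1 + center_norm A))"
proof -
  have "(\<Sum>i<Suc j. (cmod (fps_nth A i))\<^sup>2) = (center_norm A)\<^sup>2 + (\<Sum>i<j. tail_square A i)"
    by (simp add: sum.lessThan_Suc_shift del: sum.lessThan_Suc)
  hence odd: "cmod (fps_nth A (Suc (2 * j))) \<le> 1 - (center_norm A)\<^sup>2 - (\<Sum>i<j. tail_square A i)"
    and even: "cmod (fps_nth A (Suc (Suc (2 * j)))) \<le> 1 - (center_norm A)\<^sup>2 - (\<Sum>i<j. tail_square A i) - tail_square A j / (1 + center_norm A)"
    using odd_coefficient_bound[of j] even_coefficient_bound[OF _ a1, of "Suc j"]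
    by (simp_all add: lessThan_Suc_atMost)
  have pow: "r ^ Suc (2 * j) = r * (r\<^sup>2) ^ j" "r ^ Suc (Suc (2 * j)) = r\<^sup>2 * (r\<^sup>2) ^ j"
    by (simp_all add: power_mult power2_eq_square)
  have "cmod (fps_nth A (Suc (2 * j))) * r ^ Suc (2 * j) + cmod (fps_nth A (Suc (Suc (2 * j)))) * r ^ Suc (Suc (2 * j))
      \<le> (1 - (center_norm A)\<^sup>2 - (\<Sum>i<j. tail_square A i)) * r ^ Suc (2 * j) + (1 - (center_norm A)\<^sup>2 - (\<Sum>i<j. tail_square A i) - tail_square A j / (1 + center_norm A)) * r ^ Suc (Suc (2 * j))"
    using odd even r by (intro add_mono mult_right_mono) auto
  also have "\<dots> = (1 - (center_norm A)\<^sup>2) * (r ^ Suc (2 * j) + r ^ Suc (Suc (2 * j)))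
      - ((r + r\<^sup>2) * ((\<Sum>i<j. tail_square A i) * (r\<^sup>2) ^ j) + tail_square A j * (r\<^sup>2) ^ Suc j / (1 + center_norm A))"
    unfolding pow by (simp add: algebra_simps)
  finally show ?thesis .
qed

lemma summable_norm_coefficients:
  assumes "0 \<le> r" "r < 1"
  shows "summable (\<lambda>n. cmod (fps_nth A n) * r ^ n)"
  using norm_summable_fps[of "of_real r" A] norm_less_radius[of "of_real r"] assms
  by (simp add: norm_mult norm_power)

text \<open>Summed over all pairs, the quantity subtracted in the pair bound is exactly the second
  series with its factor; the summand r / (1 - r) of that factor arises as (r + r^2) / (1 -
  r^2).\<close>

lemma majorant_series_bound:
  assumes r: "0 \<le> r" "r < 1"
  shows "(\<Sum>n. cmod (fps_nth A n) * r ^ n) + (1 / (1 + center_norm A) + r / (1 - r)) * (\<Sum>n. tail_square A n * r ^ (2 * Suc n))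
    \<le> center_norm A + (1 - (center_norm A)\<^sup>2) * (r / (1 - r))"
proof (cases "center_norm A = 1")
  case True
  have "fps_nth A (Suc n) = 0" for n
    by (subst constant_if_norm_coefficient_0_eq_1[OF True]) simp
  moreover from this have "(\<Sum>n. cmod (fps_nth A n) * r ^ n) = center_norm A"
    using suminf_split_head[OF summable_norm_coefficients[OF r]] by simp
  ultimately show ?thesis using True by simp
next
  case False
  hence a1: "center_norm A < 1" using norm_coefficient_0_le by simp
  let ?x = "r\<^sup>2" and ?C = "\<Sum>n. tail_square A n * (r\<^sup>2) ^ Suc n"
  have x: "0 \<le> ?x" "?x < 1" using r by (simp_all add: abs_square_less_1)
  note B = partial_sum_series[of "tail_square A", OF zero_le_power2 tail_square_sum_le x]
  have C: "(\<lambda>j. tail_square A j * ?x ^ Suc j) sums ?C" using summable_sums[OF B(1)] .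
  have head: "(\<Sum>n. cmod (fps_nth A n) * r ^ n) = center_norm A + (\<Sum>n. cmod (fps_nth A (Suc n)) * r ^ Suc n)"
    using suminf_split_head[OF summable_norm_coefficients[OF r]] by simp
  have "summable (\<lambda>n. cmod (fps_nth A (Suc n)) * r ^ Suc n)"
    using summable_norm_coefficients[OF r] by (subst summable_Suc_iff)
  from sums_group[OF summable_sums[OF this], of 2]
  have L: "(\<lambda>j. cmod (fps_nth A (Suc (2 * j))) * r ^ Suc (2 * j) + cmod (fps_nth A (Suc (Suc (2 * j)))) * r ^ Suc (Suc (2 * j)))
      sums (\<Sum>n. cmod (fps_nth A (Suc n)) * r ^ Suc n)"
    by (simp add: mult.commute[of _ 2] numeral_2_eq_2)
  have "(\<lambda>n. r * r ^ n) sums (r * (1 / (1 - r)))"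
    using r by (intro sums_mult geometric_sums) auto
  hence "(\<lambda>n. r ^ Suc n) sums (r / (1 - r))" by simp
  from sums_group[OF this, of 2]
  have "(\<lambda>j. r ^ Suc (2 * j) + r ^ Suc (Suc (2 * j))) sums (r / (1 - r))"
    by (simp add: mult.commute[of _ 2] numeral_2_eq_2)
  hence R: "(\<lambda>j. (1 - (center_norm A)\<^sup>2) * (r ^ Suc (2 * j) + r ^ Suc (Suc (2 * j)))
      - ((r + ?x) * ((\<Sum>i<j. tail_square A i) * ?x ^ j) + tail_square A j * ?x ^ Suc j / (1 + center_norm A)))
      sums ((1 - (center_norm A)\<^sup>2) * (r / (1 - r)) - ((r + ?x) * (?C / (1 - ?x)) + ?C / (1 + center_norm A)))"
    by (intro sums_diff sums_add sums_mult sums_divide B C)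
  have "(\<Sum>n. cmod (fps_nth A (Suc n)) * r ^ Suc n)
      \<le> (1 - (center_norm A)\<^sup>2) * (r / (1 - r)) - ((r + ?x) * (?C / (1 - ?x)) + ?C / (1 + center_norm A))"
    by (rule sums_le[OF coefficient_pair_bound[OF a1 r(1)] L R])
  moreover have "(r + ?x) * (?C / (1 - ?x)) = r / (1 - r) * ?C"
  proof -
    have "1 - ?x = (1 - r) * (1 + r)" "r + ?x = r * (1 + r)" by (simp_all add: algebra_simps power2_eq_square)
    thus ?thesis using r by (simp add: divide_simps)
  qed
  moreover have "(\<Sum>n. tail_square A n * r ^ (2 * Suc n)) = ?C" by (simp only: power_mult)
  ultimately show ?thesis unfolding head by (simp add: algebra_simps)
qed

text \<open>The weights (n + 1) r^(2n + 2) decrease because r^2 <= 1/2, so summation by parts turns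
  domination of partial sums into domination of weighted sums.\<close>

lemma area_bound:
  assumes r: "0 \<le> r" "r\<^sup>2 \<le> 1 / 2"
  shows "(LINT z : ball 0 r | lborel. (cmod (deriv (eval_fps A) z))\<^sup>2) / pi
    \<le> (1 - (center_norm A)\<^sup>2)\<^sup>2 * r\<^sup>2 / (1 - (center_norm A)\<^sup>2 * r\<^sup>2)\<^sup>2"
proof -
  have r1: "r < 1"
  proof (rule ccontr)
    assume "\<not> r < 1"
    hence "1\<^sup>2 \<le> r\<^sup>2" by (intro power_mono) auto
    thus False using r by simp
  qed
  let ?w = "\<lambda>n. real (Suc n) * r ^ (2 * Suc n)"
  have w: "?w (Suc n) \<le> ?w n" for n
  proof -
    have "real (Suc (Suc n)) * r\<^sup>2 \<le> real (Suc (Suc n)) * (1 / 2)" using r by (intro mult_left_mono) auto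
    also have "\<dots> \<le> real (Suc n)" by simp
    finally have "real (Suc (Suc n)) * r\<^sup>2 * r ^ (2 * Suc n) \<le> real (Suc n) * r ^ (2 * Suc n)"
      using r by (intro mult_right_mono) auto
    thus ?thesis by (simp add: power2_eq_square mult_ac del: of_nat_Suc)
  qed
  have "ereal r < fps_conv_radius A" using norm_less_radius[of "of_real r"] r r1 by simp
  note S = area_series[OF r(1) this]
  note E = extremal_area_series[OF norm_ge_zero norm_coefficient_0_le r(1) r1, where b = "(1 - (center_norm A)\<^sup>2)\<^sup>2"]
  have "0 \<le> (\<Sum>i<n. ?w i * ((1 - (center_norm A)\<^sup>2)\<^sup>2 * ((center_norm A)\<^sup>2) ^ i - tail_square A i))" for n
    using tail_square_sum_bound r w
    by (intro weighted_sum_nonneg) (auto simp: sum_subtractf simp del: power_Suc of_nat_Suc)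
  hence "(\<Sum>i<n. ?w i * tail_square A i) \<le> (\<Sum>i<n. ?w i * ((1 - (center_norm A)\<^sup>2)\<^sup>2 * ((center_norm A)\<^sup>2) ^ i))" for n
    by (simp add: right_diff_distrib sum_subtractf)
  with S E show ?thesis unfolding sums_def by (blast intro: LIMSEQ_le)
qed

end

section \<open>The extremal problem\<close>

lemma alpha_poly_decreasing:
  assumes "0 \<le> s" "s < t" "t \<le> 1"
  shows "alpha_poly t < alpha_poly s"
proof (rule DERIV_neg_imp_decreasing[OF assms(2)])
  fix x assume x: "s \<le> x" "x \<le> t"
  have "DERIV alpha_poly x :> - 44845 - 44870 * x - 1110 * x ^ 2 + 56 * x ^ 3 - 5 * x ^ 4 + 6 * x ^ 5"
    unfolding alpha_poly_def by (auto intro!: derivative_eq_intros)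
  \<comment> \<open>The only positive terms, 56 x^3 and 6 x^5, add up to at most 62.\<close>
  moreover have "- 44845 - 44870 * x - 1110 * x ^ 2 + 56 * x ^ 3 - 5 * x ^ 4 + 6 * x ^ 5 < 0"
  proof -
    have x01: "0 \<le> x" "x \<le> 1" using x assms by auto
    hence "x ^ 3 \<le> 1" "x ^ 5 \<le> 1" "0 \<le> x ^ 2" "0 \<le> x ^ 4" by (simp_all add: power_le_one)
    thus ?thesis using x01(1) by linarith
  qed
  ultimately show "\<exists>y. DERIV alpha_poly x :> y \<and> y < 0" by blast
qed

lemma alpha_poly_root_unique: "\<exists>!t. t \<in> {0<..<1} \<and> alpha_poly t = 0"
proof -
  have "\<exists>t\<ge>0. t \<le> 1 \<and> alpha_poly t = 0"
    by (rule IVT2') (auto simp: alpha_poly_def intro!: continuous_intros)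
  then obtain t where t: "0 \<le> t" "t \<le> 1" "alpha_poly t = 0" by blast
  have "t \<noteq> 0" "t \<noteq> 1" using t(3) by (auto simp: alpha_poly_def)
  moreover have "s = t" if "0 < s" "s < 1" "alpha_poly s = 0" for s
    using alpha_poly_decreasing[of s t] alpha_poly_decreasing[of t s] t that
    by (cases s t rule: linorder_cases) auto
  ultimately show ?thesis using t by (intro ex1I[of _ t]) auto
qed

lemma alpha: "0 < alpha" "alpha < 1" "alpha_poly alpha = 0"
  using theI'[OF alpha_poly_root_unique] by (auto simp: alpha_def)

text \<open>Rational points within 5 * 10^-7 of 0.564084 that bracket the root. The bound 1 at the
  lower point later limits the slope of \<open>bohr_quotient\<close>.\<close>

lemma alpha_poly_lower_point: "0 < alpha_poly (1580 / 2801)" "alpha_poly (1580 / 2801) < 1"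
  and alpha_poly_upper_point: "alpha_poly (3182 / 5641) < 0"
  by (simp_all add: alpha_poly_def power_divide)

lemma alpha_bounds: "1580 / 2801 < alpha" "alpha < 3182 / 5641"
proof -
  have below: "t < alpha" if "0 \<le> t" "t \<le> 1" "0 < alpha_poly t" for t
    using alpha_poly_decreasing[of alpha t] alpha that by (cases alpha t rule: linorder_cases) auto
  have above: "alpha < t" if "0 \<le> t" "t \<le> 1" "alpha_poly t < 0" for t
    using alpha_poly_decreasing[of t alpha] alpha that by (cases alpha t rule: linorder_cases) auto
  show "1580 / 2801 < alpha" by (rule below[OF _ _ alpha_poly_lower_point(1)]) simp_all
  show "alpha < 3182 / 5641" by (rule above[OF _ _ alpha_poly_upper_point]) simp_all
qed

section \<open>The quotient whose minimum is \<lambda>\<close>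

text \<open>
  The value of \<open>\<lambda>\<close> for which the majorant at \<open>r = 1/5\<close> equals \<open>1\<close>; a common factor \<open>(1 - a)^3\<close> has been
  cancelled, which is possible because of the constant \<open>18/5\<close>.
\<close>

definition bohr_quotient :: "real \<Rightarrow> real" where
  "bohr_quotient a =
    (25 - a ^ 2) ^ 2 * (1015 + 445 * a + 5 * a ^ 2 - a ^ 3) / (2500 * (1 - a) * (1 + a) ^ 4)"

lemma DERIV_bohr_quotient:
  assumes "0 \<le> a" "a < 1"
  shows "DERIV bohr_quotient a :> - (2 * (25 - a ^ 2) / (2500 * (1 - a) ^ 2 * (1 + a) ^ 5)) * alpha_poly a"
proof -
  have nz: "1 - a \<noteq> 0" "1 + a \<noteq> 0" using assms by auto
  define Q where "Q = 1015 + 445 * a + 5 * a ^ 2 - a ^ 3"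
  define N' where "N' = 2 * (25 - a ^ 2) * (- 2 * a) * Q + (25 - a ^ 2) ^ 2 * (445 + 10 * a - 3 * a ^ 2)"
  define M' where "M' = 2500 * (- ((1 + a) ^ 4) + (1 - a) * (4 * (1 + a) ^ 3))"
  let ?N = "(25 - a ^ 2) ^ 2 * Q" and ?M = "2500 * (1 - a) * (1 + a) ^ 4"
  have "DERIV bohr_quotient a :> (N' * ?M - ?N * M') / (?M * ?M)"
    unfolding bohr_quotient_def Q_def N'_def M'_def
    by (rule DERIV_divide) (use nz in \<open>auto intro!: derivative_eq_intros simp: algebra_simps\<close>)
  \<comment> \<open>The factor 2500 (1 + a)^3 also divides the squared denominator and is cancelled
    below.\<close>
  moreover have "N' * ?M - ?N * M' = - (2 * (25 - a ^ 2)) * alpha_poly a * (2500 * (1 + a) ^ 3)"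
    unfolding N'_def M'_def Q_def alpha_poly_def by algebra
  moreover have "?M * ?M = 2500 * (1 - a) ^ 2 * (1 + a) ^ 5 * (2500 * (1 + a) ^ 3)"
    by algebra
  moreover have "- (2 * (25 - a ^ 2)) * alpha_poly a * (2500 * (1 + a) ^ 3)
      / (2500 * (1 - a) ^ 2 * (1 + a) ^ 5 * (2500 * (1 + a) ^ 3))
      = - (2 * (25 - a ^ 2) / (2500 * (1 - a) ^ 2 * (1 + a) ^ 5)) * alpha_poly a"
    using nz by (subst mult_divide_mult_cancel_right)
      (simp, simp only: mult_minus_left times_divide_eq_left minus_divide_left)
  ultimately show ?thesis by (simp only:)
qed

text \<open>The slope has the sign opposite to \<open>alpha_poly\<close>, which is positive before
  \<open>alpha\<close> and negative after it.\<close>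

lemma bohr_quotient_minimum:
  assumes a: "0 \<le> a" "a < 1"
  shows "bohr_quotient alpha \<le> bohr_quotient a"
proof -
  let ?d = "\<lambda>x. - (2 * (25 - x ^ 2) / (2500 * (1 - x) ^ 2 * (1 + x) ^ 5)) * alpha_poly x"
  have pos: "0 \<le> 2 * (25 - x ^ 2) / (2500 * (1 - x) ^ 2 * (1 + x) ^ 5)" if "0 \<le> x" "x < 1" for x :: real
  proof -
    have "x ^ 2 \<le> 1" using that by (simp add: abs_square_le_1)
    thus ?thesis using that by (intro divide_nonneg_nonneg mult_nonneg_nonneg) auto
  qed
  show ?thesis
  proof (cases "a \<le> alpha")
    case True
    have "bohr_quotient a \<ge> bohr_quotient alpha"
    proof (rule DERIV_nonpos_imp_nonincreasing[OF True])
      fix x assume x: "a \<le> x" "x \<le> alpha"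
      have "0 \<le> alpha_poly x"
        using alpha_poly_decreasing[of x alpha] x a alpha by (cases "x = alpha") auto
      hence "?d x \<le> 0" using pos[of x] x a alpha by (simp only: mult_minus_left neg_le_0_iff_le) (intro mult_nonneg_nonneg; simp)
      moreover have "DERIV bohr_quotient x :> ?d x" using x a alpha by (intro DERIV_bohr_quotient) auto
      ultimately show "\<exists>y. DERIV bohr_quotient x :> y \<and> y \<le> 0" by blast
    qed
    thus ?thesis .
  next
    case False
    hence le: "alpha \<le> a" by simp
    show ?thesis
    proof (rule DERIV_nonneg_imp_nondecreasing[OF le])
      fix x assume x: "alpha \<le> x" "x \<le> a"
      have "alpha_poly x \<le> 0"
        using alpha_poly_decreasing[of alpha x] x a alpha by (cases "x = alpha") auto
      hence "0 \<le> ?d x" using pos[of x] x a alpha by (simp only: mult_minus_left neg_0_le_iff_le) (intro mult_nonneg_nonpos; simp)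
      moreover have "DERIV bohr_quotient x :> ?d x" using x a alpha by (intro DERIV_bohr_quotient) auto
      ultimately show "\<exists>y. DERIV bohr_quotient x :> y \<and> 0 \<le> y" by blast
    qed
  qed
qed

text \<open>The two closed forms are different functions: cross-multiplied, they differ by a
  multiple of \<open>alpha_poly\<close>, so they agree at its root.\<close>

lemma lambda_const_eq: "lambda_const = bohr_quotient alpha"
proof -
  let ?N = "11125 - 3810 * alpha - 2300 * alpha ^ 2 - 30 * alpha ^ 3 + 7 * alpha ^ 4"
  let ?Q = "1015 + 445 * alpha + 5 * alpha ^ 2 - alpha ^ 3"
  have "?N * ((1 - alpha) * (1 + alpha)) - (25 - alpha ^ 2) * ?Q * (3 - 5 * alpha) = - 2 * alpha_poly alpha"
    unfolding alpha_poly_def by algebra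
  hence eq: "?N * ((1 - alpha) * (1 + alpha)) = (25 - alpha ^ 2) * ?Q * (3 - 5 * alpha)"
    using alpha(3) by simp
  have nz: "3 - 5 * alpha \<noteq> 0" "1 - alpha \<noteq> 0" "1 + alpha \<noteq> 0" using alpha alpha_bounds by auto
  have "(25 - alpha ^ 2) * ?N * (2500 * (1 - alpha) * (1 + alpha) ^ 4)
      = (25 - alpha ^ 2) * 2500 * (1 + alpha) ^ 3 * (?N * ((1 - alpha) * (1 + alpha)))" by algebra
  also have "\<dots> = (25 - alpha ^ 2) ^ 2 * ?Q * (2500 * (1 + alpha) ^ 3 * (3 - 5 * alpha))"
    unfolding eq by algebra
  finally show ?thesis
    unfolding lambda_const_def bohr_quotient_def using nz by (subst frac_eq_eq) auto
qed

text \<open>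
  As \<open>bohr_quotient\<close> is stationary at \<open>alpha\<close>, the crude approximation \<open>1580/2801\<close> of \<open>alpha\<close>
  determines its minimum to the required accuracy.
\<close>

lemma lambda_const_bounds: "118.384394 \<le> lambda_const" "lambda_const < 118.384395"
proof -
  let ?l = "1580 / 2801 :: real"
  have vals: "118.3843945 \<le> bohr_quotient ?l" "bohr_quotient ?l < 118.384395"
    by (simp_all add: bohr_quotient_def power_divide)
  have "bohr_quotient alpha \<le> bohr_quotient ?l" by (rule bohr_quotient_minimum) simp_all
  thus "lambda_const < 118.384395" using vals(2) unfolding lambda_const_eq by linarith
  \<comment> \<open>Between \<open>?l\<close> and \<open>alpha\<close> the slope of
    \<open>bohr_quotient\<close> is at least -1, so the value drops by at most
    \<open>alpha - ?l\<close>, which is below 1.3 * 10^-7.\<close>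
  have "bohr_quotient ?l + ?l \<le> bohr_quotient alpha + alpha"
  proof (rule DERIV_nonneg_imp_nondecreasing[OF less_imp_le[OF alpha_bounds(1)]])
    fix x assume x: "?l \<le> x" "x \<le> alpha"
    define d where "d = 2500 * (1 - x) ^ 2 * (1 + x) ^ 5"
    let ?k = "2 * (25 - x ^ 2) / d"
    have x01: "0 \<le> x" "x < 1" "x \<le> 3 / 5" using x alpha_bounds by auto
    have "2500 * (2 / 5) ^ 2 * 1 \<le> d"
      unfolding d_def using x01 by (intro mult_mono power_mono one_le_power) auto
    hence d: "400 \<le> d" by (simp add: power2_eq_square)
    have "x ^ 2 \<le> 1" using x01 by (simp add: abs_square_le_1)
    hence "0 \<le> 2 * (25 - x ^ 2)" by simp
    moreover have "2 * (25 - x ^ 2) \<le> 50" by simp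
    hence "2 * (25 - x ^ 2) \<le> d" using d by linarith
    ultimately have k: "0 \<le> ?k" "?k \<le> 1" using d by simp_all
    have "alpha_poly x \<le> alpha_poly ?l"
    proof (cases "x = ?l")
      case False
      hence "alpha_poly x < alpha_poly ?l" using x x01 by (intro alpha_poly_decreasing) auto
      thus ?thesis by simp
    qed (simp only: order_refl)
    hence "?k * alpha_poly x \<le> ?k * 1"
      using k(1) alpha_poly_lower_point(2) by (intro mult_left_mono) auto
    hence "0 \<le> - ?k * alpha_poly x + 1" using k(2) by simp
    moreover have "DERIV (\<lambda>x. bohr_quotient x + x) x :> - ?k * alpha_poly x + 1"
      unfolding d_def by (intro DERIV_add DERIV_bohr_quotient DERIV_ident x01)
    ultimately show "\<exists>y. DERIV (\<lambda>x. bohr_quotient x + x) x :> y \<and> 0 \<le> y" by blast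
  qed
  thus "118.384394 \<le> lambda_const"
    using vals(1) alpha_bounds(2) unfolding lambda_const_eq by simp
qed

section \<open>The majorant and its value at r = 1/5\<close>

text \<open>The left-hand side with every ingredient replaced by its bound; the two series together
  account for the first two summands.\<close>

definition bohr_majorant :: "real \<Rightarrow> real \<Rightarrow> real" where
  "bohr_majorant a r = a + (1 - a\<^sup>2) * (r / (1 - r)) + r * (1 - a\<^sup>2) / (1 - a * r)
    + 18 / 5 * ((1 - a\<^sup>2)\<^sup>2 * r\<^sup>2 / (1 - a\<^sup>2 * r\<^sup>2)\<^sup>2)
    + lambda_const * ((1 - a\<^sup>2)\<^sup>2 * r\<^sup>2 / (1 - a\<^sup>2 * r\<^sup>2)\<^sup>2)\<^sup>2"

text \<open>Reduces smaller radii to 1/5. Apart from the constant a, numerators grow with r while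
  the positive denominators do not, and \<open>lambda_const\<close> is positive.\<close>

lemma bohr_majorant_mono:
  assumes a: "0 \<le> a" "a \<le> 1" and r: "0 \<le> r" "r \<le> s" "s < 1"
  shows "bohr_majorant a r \<le> bohr_majorant a s"
proof -
  have a2: "0 \<le> 1 - a\<^sup>2" using a by (simp add: abs_square_le_1)
  have as: "a * s < 1" using mult_right_mono[OF a(2), of s] r by simp
  have rs: "r\<^sup>2 \<le> s\<^sup>2" using r by (simp add: power_mono)
  have "a\<^sup>2 * s\<^sup>2 = (a * s)\<^sup>2" by (simp add: power_mult_distrib)
  also have "\<dots> < 1" using as a r by (simp add: abs_square_less_1)
  finally have as2: "a\<^sup>2 * s\<^sup>2 < 1" .
  have ars: "a\<^sup>2 * r\<^sup>2 \<le> a\<^sup>2 * s\<^sup>2" using rs by (intro mult_left_mono) auto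
  have "(1 - a\<^sup>2) * (r / (1 - r)) \<le> (1 - a\<^sup>2) * (s / (1 - s))"
    using a2 r by (intro mult_left_mono frac_le) auto
  moreover have "r * (1 - a\<^sup>2) / (1 - a * r) \<le> s * (1 - a\<^sup>2) / (1 - a * s)"
    using a2 r as a mult_left_mono[OF r(2) a(1)] by (intro frac_le mult_right_mono) auto
  moreover have E: "(1 - a\<^sup>2)\<^sup>2 * r\<^sup>2 / (1 - a\<^sup>2 * r\<^sup>2)\<^sup>2 \<le> (1 - a\<^sup>2)\<^sup>2 * s\<^sup>2 / (1 - a\<^sup>2 * s\<^sup>2)\<^sup>2"
    using r rs as2 ars by (intro frac_le mult_left_mono power_mono) auto
  moreover have "lambda_const * ((1 - a\<^sup>2)\<^sup>2 * r\<^sup>2 / (1 - a\<^sup>2 * r\<^sup>2)\<^sup>2)\<^sup>2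
      \<le> lambda_const * ((1 - a\<^sup>2)\<^sup>2 * s\<^sup>2 / (1 - a\<^sup>2 * s\<^sup>2)\<^sup>2)\<^sup>2"
    using E lambda_const_bounds by (intro mult_left_mono power_mono) auto
  ultimately show ?thesis unfolding bohr_majorant_def by linarith
qed

text \<open>The last factor is the squared area bound, that is, the coefficient of
  \<open>lambda_const\<close>. Without the \<open>lambda_const\<close> term the slack to 1 is
  \<open>bohr_quotient a\<close> times this factor.\<close>

lemma bohr_majorant_one_fifth:
  assumes "0 \<le> a" "a < 1"
  shows "bohr_majorant a (1 / 5) = 1 - (bohr_quotient a - lambda_const) * (625 * (1 - a ^ 2) ^ 4 / (25 - a ^ 2) ^ 4)"
proof -
  have a2: "a ^ 2 < 1" using assms by (simp add: abs_square_less_1)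
  have nz: "5 - a \<noteq> 0" "5 + a \<noteq> 0" "25 - a ^ 2 \<noteq> 0" "1 - a \<noteq> 0" "1 + a \<noteq> 0" using assms a2 by auto
  let ?Q = "1015 + 445 * a + 5 * a ^ 2 - a ^ 3"
  have E: "(1 - a\<^sup>2)\<^sup>2 * (1 / 5)\<^sup>2 / (1 - a\<^sup>2 * (1 / 5)\<^sup>2)\<^sup>2 = 25 * (1 - a ^ 2) ^ 2 / (25 - a ^ 2) ^ 2"
  proof -
    have "1 - a\<^sup>2 * (1 / 5)\<^sup>2 = (25 - a ^ 2) / 25" by (simp add: power2_eq_square)
    thus ?thesis by (simp only: power_divide) simp
  qed
  have D: "1 / 5 * (1 - a\<^sup>2) / (1 - a * (1 / 5)) = (1 - a ^ 2) / (5 - a)"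
    using nz by (simp add: divide_simps) (simp add: algebra_simps)
  have "bohr_quotient a * (625 * (1 - a ^ 2) ^ 4 / (25 - a ^ 2) ^ 4) = (1 - a) ^ 3 * ?Q / (4 * (25 - a ^ 2) ^ 2)"
  proof -
    have "(25 - a ^ 2) ^ 2 * ?Q * (625 * (1 - a ^ 2) ^ 4) * (4 * (25 - a ^ 2) ^ 2)
      = (1 - a) ^ 3 * ?Q * (2500 * (1 - a) * (1 + a) ^ 4 * (25 - a ^ 2) ^ 4)" by algebra
    thus ?thesis unfolding bohr_quotient_def times_divide_times_eq using nz by (subst frac_eq_eq) auto
  qed
  also have "\<dots> = 1 - a - (1 - a ^ 2) / 4 - (1 - a ^ 2) / (5 - a) - 18 / 5 * (25 * (1 - a ^ 2) ^ 2 / (25 - a ^ 2) ^ 2)"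
  proof -
    have "25 - a ^ 2 = (5 - a) * (5 + a)" by (simp add: algebra_simps power2_eq_square)
    hence "(1 - a ^ 2) / (5 - a) = (1 - a ^ 2) * (5 + a) * (25 - a ^ 2) / (25 - a ^ 2) ^ 2"
      using nz by (simp add: power2_eq_square)
    moreover have "1 - a - (1 - a ^ 2) / 4 = (1 - a - (1 - a ^ 2) / 4) * (25 - a ^ 2) ^ 2 / (25 - a ^ 2) ^ 2"
      using nz by simp
    \<comment> \<open>The coefficient 90 is 18/5 times 25; this value makes the right-hand side
      divisible by (1 - a)^3.\<close>
    moreover have "(1 - a) ^ 3 * ?Q / 4 = (1 - a - (1 - a ^ 2) / 4) * (25 - a ^ 2) ^ 2
        - (1 - a ^ 2) * (5 + a) * (25 - a ^ 2) - 90 * (1 - a ^ 2) ^ 2"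
      by (simp add: field_simps) algebra
    ultimately show ?thesis
      by (simp add: diff_divide_distrib flip: divide_divide_eq_left)
  qed
  finally have key: "bohr_quotient a * (625 * (1 - a ^ 2) ^ 4 / (25 - a ^ 2) ^ 4)
    = 1 - a - (1 - a ^ 2) / 4 - (1 - a ^ 2) / (5 - a) - 18 / 5 * (25 * (1 - a ^ 2) ^ 2 / (25 - a ^ 2) ^ 2)" .
  have sq: "(25 * (1 - a ^ 2) ^ 2 / (25 - a ^ 2) ^ 2) ^ 2 = 625 * (1 - a ^ 2) ^ 4 / (25 - a ^ 2) ^ 4"
    by (simp add: power_divide power_mult_distrib flip: power_mult)
  show ?thesis
    unfolding bohr_majorant_def E D sq left_diff_distrib key by simp
qed

lemma bohr_majorant_le_1:
  assumes "0 \<le> a" "a \<le> 1"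
  shows "bohr_majorant a (1 / 5) \<le> 1"
\<comment> \<open>At a = 1 the denominator of \<open>bohr_quotient\<close> vanishes, while the
  majorant is just a.\<close>
proof (cases "a = 1")
  case False
  hence a: "a < 1" using assms by simp
  have "lambda_const \<le> bohr_quotient a"
    unfolding lambda_const_eq using assms(1) a by (rule bohr_quotient_minimum)
  hence "0 \<le> (bohr_quotient a - lambda_const) * (625 * (1 - a ^ 2) ^ 4 / (25 - a ^ 2) ^ 4)"
    by (intro mult_nonneg_nonneg divide_nonneg_nonneg) auto
  thus ?thesis unfolding bohr_majorant_one_fifth[OF assms(1) a] by simp
qed (simp add: bohr_majorant_def)

lemma bohr_majorant_alpha: "bohr_majorant alpha (1 / 5) = 1"
  using bohr_majorant_one_fifth[of alpha] alpha by (simp add: lambda_const_eq)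

section \<open>The inequality and its sharpness\<close>

lemma deriv_eval_fps_expansion:
  assumes "f holomorphic_on ball 0 1" "cmod z < 1"
  shows "deriv (eval_fps (fps_expansion f 0)) z = deriv f z"
proof (rule deriv_cong_ev)
  have "f holomorphic_on eball 0 1" using assms(1) by (metis eball_ereal one_ereal_def)
  thus "\<forall>\<^sub>F x in nhds z. eval_fps (fps_expansion f 0) x = f x"
    using assms(2) eval_fps_expansion'[of f 0 1]
    by (intro eventually_nhds_in_open[of "ball 0 1", THEN eventually_mono]) auto
qed simp

lemma area_S_eq:
  assumes "f holomorphic_on ball 0 1" "r \<le> 1"
  shows "area_S f r = (LINT z : ball 0 r | lborel. (cmod (deriv (eval_fps (fps_expansion f 0)) z))\<^sup>2)"
  unfolding area_S_def using assms
  by (intro set_lebesgue_integral_cong) (auto simp: deriv_eval_fps_expansion)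

text \<open>The separate bounds add up; squaring the area bound uses that the area is nonnegative.
  The restriction on |z| comes from \<open>area_bound\<close>.\<close>

lemma bohr_lhs_le_majorant:
  assumes f: "f holomorphic_on ball 0 1" "\<And>w. cmod w < 1 \<Longrightarrow> cmod (f w) \<le> 1"
    and z: "(cmod z)\<^sup>2 \<le> 1 / 2"
  shows "bohr_lhs f z \<le> bohr_majorant (cmod (taylor_coeff f 0)) (cmod z)"
proof -
  have z1: "cmod z < 1"
  proof (rule ccontr)
    assume "\<not> cmod z < 1"
    hence "1\<^sup>2 \<le> (cmod z)\<^sup>2" by (intro power_mono) auto
    thus False using z by simp
  qed
  define A where "A = fps_expansion f 0"
  have A: "1 \<le> fps_conv_radius A" "\<And>z. cmod z < 1 \<Longrightarrow> cmod (eval_fps A z) \<le> 1"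
    unfolding A_def using radius_fps_expansion[OF f] bounded_fps_expansion[OF f] by blast+
  have "f holomorphic_on eball 0 1" using f(1) by (metis eball_ereal one_ereal_def)
  hence fz: "eval_fps A z = f z"
    using eval_fps_expansion'[of f 0 1 z] z1 by (simp add: A_def)
  have coeff: "taylor_coeff f = fps_nth A" by (rule ext) (simp add: taylor_coeff_def A_def)
  let ?r = "cmod z"
  let ?a = "center_norm A"
  let ?S = "area_S f ?r / pi" and ?E = "(1 - ?a\<^sup>2)\<^sup>2 * ?r\<^sup>2 / (1 - ?a\<^sup>2 * ?r\<^sup>2)\<^sup>2"
  have S: "?S \<le> ?E" "0 \<le> ?S"
  proof -
    have "?S = (LINT z : ball 0 ?r | lborel. (cmod (deriv (eval_fps A) z))\<^sup>2) / pi"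
      using f(1) z1 by (simp add: area_S_eq A_def)
    thus "?S \<le> ?E" using area_bound[OF A norm_ge_zero z] by simp
    show "0 \<le> ?S"
      unfolding area_S_def set_lebesgue_integral_def by (intro divide_nonneg_pos integral_nonneg) auto
  qed
  hence "lambda_const * ?S\<^sup>2 \<le> lambda_const * ?E\<^sup>2"
    using lambda_const_bounds by (intro mult_left_mono power_mono) auto
  moreover note S majorant_series_bound[OF A norm_ge_zero z1] distance_from_center_bound[OF A z1]
  ultimately show ?thesis
    unfolding bohr_lhs_def bohr_majorant_def Let_def coeff fz by linarith
qed

section \<open>The Moebius map as extremal function\<close>

lemma disc_automorphism_bounded:
  assumes "0 \<le> a" "a < 1" "cmod w < 1"
  shows "1 - of_real a * w \<noteq> 0" "cmod (disc_automorphism a w) \<le> 1"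
proof -
  have "a * cmod w \<le> 1 * cmod w" using assms by (intro mult_right_mono) auto
  hence "cmod (of_real a * w) < 1" using assms by (simp add: norm_mult)
  thus nz: "1 - of_real a * w \<noteq> 0" by auto
  have "(cmod (1 - of_real a * w))\<^sup>2 - (cmod (of_real a - w))\<^sup>2 = (1 - a\<^sup>2) * (1 - (cmod w)\<^sup>2)"
    unfolding cmod_power2 by (simp add: algebra_simps power2_eq_square)
  moreover have "0 \<le> (1 - a\<^sup>2) * (1 - (cmod w)\<^sup>2)"
    using assms by (intro mult_nonneg_nonneg) (simp_all add: abs_square_le_1)
  ultimately have "(cmod (of_real a - w))\<^sup>2 \<le> (cmod (1 - of_real a * w))\<^sup>2" by linarith
  hence "cmod (of_real a - w) \<le> cmod (1 - of_real a * w)" by (rule power2_le_imp_le) simp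
  thus "cmod (disc_automorphism a w) \<le> 1" using nz by (simp add: disc_automorphism_def norm_divide)
qed

lemma disc_automorphism_holomorphic:
  assumes "0 \<le> a" "a < 1"
  shows "disc_automorphism a holomorphic_on ball 0 1"
  unfolding disc_automorphism_def
  by (intro holomorphic_intros) (use disc_automorphism_bounded(1)[OF assms] in auto)

text \<open>Clearing the denominator gives (1 - a X) A = a - X; comparing coefficients, each one of
  index at least 2 is a times its predecessor.\<close>

lemma taylor_coeff_disc_automorphism:
  assumes a: "0 \<le> a" "a < 1"
  shows "taylor_coeff (disc_automorphism a) 0 = of_real a"
    and "taylor_coeff (disc_automorphism a) (Suc n) = - of_real ((1 - a\<^sup>2) * a ^ n)"
proof -
  let ?f = "disc_automorphism a"
  define A where "A = fps_expansion ?f 0"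
  have coeff: "taylor_coeff ?f = fps_nth A" by (rule ext) (simp add: taylor_coeff_def A_def)
  have holo: "?f holomorphic_on eball 0 1"
    using disc_automorphism_holomorphic[OF a] by (metis eball_ereal one_ereal_def)
  have rA: "1 \<le> fps_conv_radius A" unfolding A_def by (rule conv_radius_fps_expansion[OF holo])
  let ?D = "1 - fps_const (of_real a) * fps_X :: complex fps"
  have rX: "fps_conv_radius (fps_const (of_real a) * fps_X :: complex fps) = \<infinity>"
    using fps_conv_radius_mult[of "fps_const (of_real a)" "fps_X :: complex fps"] by simp
  have rD: "fps_conv_radius ?D = \<infinity>"
    using fps_conv_radius_diff[of 1 "fps_const (of_real a) * fps_X :: complex fps"] rX by simp
  have "?D * A = fps_const (of_real a) - fps_X"
  proof (rule eval_fps_eqD)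
    have "1 \<le> fps_conv_radius (?D * A)" using fps_conv_radius_mult[of ?D A] rD rA by simp
    thus "0 < fps_conv_radius (?D * A)" by (rule less_le_trans[rotated]) simp
    show "0 < fps_conv_radius (fps_const (of_real a) - fps_X :: complex fps)"
      using fps_conv_radius_diff[of "fps_const (of_real a)" "fps_X :: complex fps"] by (auto intro: less_le_trans)
    have "eval_fps (?D * A) z = eval_fps (fps_const (of_real a) - fps_X) z" if z: "cmod z < 1" for z
    proof -
      have "ereal (cmod z) < fps_conv_radius A" using z rA by (metis ereal_less(3) less_le_trans)
      hence "eval_fps (?D * A) z = (1 - of_real a * z) * eval_fps A z"
        by (simp add: eval_fps_mult eval_fps_diff rD rX)
      also have "eval_fps A z = ?f z"
        using eval_fps_expansion'[OF holo, of z] z by (simp add: A_def)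
      also have "(1 - of_real a * z) * ?f z = of_real a - z"
        using disc_automorphism_bounded(1)[OF a z] by (simp add: disc_automorphism_def)
      also have "\<dots> = eval_fps (fps_const (of_real a) - fps_X) z" by (simp add: eval_fps_diff)
      finally show ?thesis .
    qed
    thus "\<forall>\<^sub>F z in nhds 0. eval_fps (?D * A) z = eval_fps (fps_const (of_real a) - fps_X) z"
      by (intro eventually_nhds_in_open[of "ball 0 1", THEN eventually_mono]) auto
  qed
  hence eq: "A = fps_const (of_real a) - fps_X + fps_const (of_real a) * (fps_X * A)"
    by (simp add: algebra_simps)
  have nth: "fps_nth A n = fps_nth (fps_const (of_real a) - fps_X + fps_const (of_real a) * (fps_X * A)) n" for n
    using eq by (rule arg_cong)
  have A0: "fps_nth A 0 = of_real a" using nth[of 0] by simp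
  thus "taylor_coeff ?f 0 = of_real a" by (simp add: coeff)
  have "fps_nth A (Suc n) = - of_real ((1 - a\<^sup>2) * a ^ n)"
  proof (induction n)
    case 0
    show ?case using nth[of 1] A0 by (simp add: power2_eq_square)
  next
    case (Suc n)
    have "fps_nth A (Suc (Suc n)) = of_real a * fps_nth A (Suc n)"
      using nth[of "Suc (Suc n)"] by (simp add: fps_X_mult_nth fps_X_nth)
    thus ?case by (simp add: Suc.IH)
  qed
  thus "taylor_coeff ?f (Suc n) = - of_real ((1 - a\<^sup>2) * a ^ n)" by (simp add: coeff)
qed

text \<open>At the positive real point z = r the area and the distance from a_0 attain their bounds,
  and the two series attain their joint bound.\<close>

lemma bohr_lhs_disc_automorphism:
  assumes a: "0 \<le> a" "a < 1" and r: "0 \<le> r" "r < 1"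
  shows "bohr_lhs (disc_automorphism a) (of_real r) = bohr_majorant a r"
proof -
  let ?f = "disc_automorphism a"
  note coeff = taylor_coeff_disc_automorphism[OF a]
  have a2: "0 \<le> 1 - a\<^sup>2" using a by (simp add: abs_square_le_1)
  have ar: "a * r < 1" using mult_right_mono[of a 1 r] a r by simp
  have "0 < 1 + a * r" using mult_nonneg_nonneg[OF a(1) r(1)] by linarith
  hence nz: "1 - a * r \<noteq> 0" "1 + a * r \<noteq> 0" "1 - r \<noteq> 0" "1 + a \<noteq> 0"
    using ar a r by auto
  have norm_coeff: "cmod (taylor_coeff ?f (Suc n)) = (1 - a\<^sup>2) * a ^ n" for n
    unfolding coeff norm_minus_cancel norm_of_real using a2 a by simp
  have "(\<lambda>n. (1 - a\<^sup>2) * r * (a * r) ^ n) sums ((1 - a\<^sup>2) * r * (1 / (1 - a * r)))"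
    using ar a r by (intro sums_mult geometric_sums) auto
  hence "(\<lambda>n. cmod (taylor_coeff ?f (Suc n)) * r ^ Suc n) sums ((1 - a\<^sup>2) * r / (1 - a * r))"
    by (simp add: norm_coeff power_mult_distrib mult_ac)
  hence "(\<lambda>n. cmod (taylor_coeff ?f n) * r ^ n) sums ((1 - a\<^sup>2) * r / (1 - a * r) + a)"
    using a by (subst (asm) sums_Suc_iff) (simp add: coeff)
  hence s1: "(\<Sum>n. cmod (taylor_coeff ?f n) * r ^ n) = a + (1 - a\<^sup>2) * r / (1 - a * r)"
    by (simp add: sums_iff)
  have "norm ((a * r)\<^sup>2) < 1" using ar a r by (simp add: abs_square_less_1)
  from sums_mult[OF geometric_sums[OF this], of "(1 - a\<^sup>2)\<^sup>2 * r\<^sup>2"]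
  have "(\<lambda>n. (1 - a\<^sup>2)\<^sup>2 * r\<^sup>2 * ((a * r)\<^sup>2) ^ n) sums ((1 - a\<^sup>2)\<^sup>2 * r\<^sup>2 / (1 - (a * r)\<^sup>2))" by simp
  moreover have "(1 - a\<^sup>2)\<^sup>2 * r\<^sup>2 * ((a * r)\<^sup>2) ^ n = (cmod (taylor_coeff ?f (Suc n)))\<^sup>2 * r ^ (2 * Suc n)" for n
  proof -
    have "((a * r)\<^sup>2) ^ n = (a ^ n)\<^sup>2 * r ^ (2 * n)"
      unfolding power_mult_distrib by (simp only: power_mult[symmetric] mult.commute)
    thus ?thesis by (simp add: norm_coeff power_mult_distrib power2_eq_square)
  qed
  ultimately have s2: "(\<Sum>n. (cmod (taylor_coeff ?f (Suc n)))\<^sup>2 * r ^ (2 * Suc n)) = (1 - a\<^sup>2)\<^sup>2 * r\<^sup>2 / (1 - (a * r)\<^sup>2)"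
    by (simp only: sums_iff)
  \<comment> \<open>The numerator 1 + a r of 1 / (1 + a) + r / (1 - r) cancels a factor of 1 - (a
    r)^2, after which the two series combine.\<close>
  have s12: "(1 - a\<^sup>2) * r / (1 - a * r) + (1 / (1 + a) + r / (1 - r)) * ((1 - a\<^sup>2)\<^sup>2 * r\<^sup>2 / (1 - (a * r)\<^sup>2))
      = (1 - a\<^sup>2) * (r / (1 - r))"
  proof -
    have e1: "1 / (1 + a) + r / (1 - r) = (1 + a * r) / ((1 + a) * (1 - r))"
      using nz by (simp add: divide_simps) (simp add: algebra_simps)
    have e2: "1 - (a * r)\<^sup>2 = (1 - a * r) * (1 + a * r)" by (simp add: algebra_simps power2_eq_square)
    have e3: "(1 - a\<^sup>2)\<^sup>2 = (1 - a\<^sup>2) * ((1 - a) * (1 + a))" by (simp add: algebra_simps power2_eq_square)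
    have e4: "(1 / (1 + a) + r / (1 - r)) * ((1 - a\<^sup>2)\<^sup>2 * r\<^sup>2 / (1 - (a * r)\<^sup>2))
        = (1 - a\<^sup>2) * (1 - a) * r\<^sup>2 / ((1 - r) * (1 - a * r))"
      unfolding e1 e2 e3 times_divide_times_eq using nz by (subst frac_eq_eq) (auto simp: mult_ac)
    show ?thesis unfolding e4 using nz by (simp add: divide_simps) (simp add: algebra_simps power2_eq_square)
  qed
  have "of_real a * complex_of_real r \<noteq> 1" using nz(1) by (metis eq_iff_diff_eq_0 of_real_1 of_real_eq_iff of_real_mult)
  hence "?f (of_real r) - of_real a = - of_real (r * (1 - a\<^sup>2) / (1 - a * r))"
    by (simp add: disc_automorphism_def divide_simps) (simp add: algebra_simps power2_eq_square)
  hence s3: "cmod (?f (of_real r) - taylor_coeff ?f 0) = r * (1 - a\<^sup>2) / (1 - a * r)"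
    unfolding coeff by (simp only: norm_minus_cancel norm_of_real) (use a2 r ar in simp)
  have s4: "area_S ?f r / pi = (1 - a\<^sup>2)\<^sup>2 * r\<^sup>2 / (1 - a\<^sup>2 * r\<^sup>2)\<^sup>2"
  proof -
    have "1 \<le> fps_conv_radius (fps_expansion ?f 0)"
      using disc_automorphism_holomorphic[OF a] disc_automorphism_bounded(2)[OF a] by (rule radius_fps_expansion)
    hence "ereal r < fps_conv_radius (fps_expansion ?f 0)"
      using r by (metis ereal_less(3) less_le_trans)
    from area_series[OF r(1) this]
    have "(\<lambda>n. real (Suc n) * r ^ (2 * Suc n) * (cmod (taylor_coeff ?f (Suc n)))\<^sup>2) sums (area_S ?f r / pi)"
      using r disc_automorphism_holomorphic[OF a] by (simp only: taylor_coeff_def area_S_eq less_imp_le)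
    moreover have "(cmod (taylor_coeff ?f (Suc n)))\<^sup>2 = (1 - a\<^sup>2)\<^sup>2 * (a\<^sup>2) ^ n" for n
      unfolding norm_coeff power_mult_distrib by (simp only: power_mult[symmetric] mult.commute)
    ultimately show ?thesis
      using extremal_area_series[OF a(1) less_imp_le[OF a(2)] r, of "(1 - a\<^sup>2)\<^sup>2"] sums_unique2
      by (simp only:)
  qed
  show ?thesis
    unfolding bohr_lhs_def bohr_majorant_def Let_def norm_of_real abs_of_nonneg[OF r(1)] s1 s2 s3 s4
    unfolding coeff norm_of_real abs_of_nonneg[OF a(1)] using s12 by linarith
qed

theorem theorem2p9:
  shows "(\<exists>!t::real. t \<in> {0<..<1} \<and> alpha_poly t = 0)
    \<and> \<bar>alpha - 0.564084\<bar> < 0.0000005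
    \<and> 118.384394 \<le> lambda_const \<and> lambda_const < 118.384395
    \<and> (\<forall>f :: complex \<Rightarrow> complex.
          f analytic_on ball 0 1 \<longrightarrow> (\<forall>w \<in> ball 0 1. cmod (f w) \<le> 1) \<longrightarrow>
          (\<forall>z. cmod z \<le> 1 / 5 \<longrightarrow> bohr_lhs f z \<le> 1))
    \<and> (disc_automorphism alpha analytic_on ball 0 1
        \<and> (\<forall>w \<in> ball 0 1. cmod (disc_automorphism alpha w) \<le> 1)
        \<and> (\<exists>z. cmod z = 1 / 5 \<and> bohr_lhs (disc_automorphism alpha) z = 1))"
proof (intro conjI allI impI ballI)
  show "\<exists>!t::real. t \<in> {0<..<1} \<and> alpha_poly t = 0" by (rule alpha_poly_root_unique)
  show "\<bar>alpha - 0.564084\<bar> < 0.0000005" using alpha_bounds by (simp add: abs_if)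
  show "118.384394 \<le> lambda_const" "lambda_const < 118.384395" by (rule lambda_const_bounds)+
next
  fix f :: "complex \<Rightarrow> complex" and z
  assume f: "f analytic_on ball 0 1" "\<forall>w\<in>ball 0 1. cmod (f w) \<le> 1" and z: "cmod z \<le> 1 / 5"
  have holo: "f holomorphic_on ball 0 1" using f(1) by (rule analytic_imp_holomorphic)
  \<comment> \<open>The zeroth Taylor coefficient is \<open>f 0\<close>.\<close>
  have a: "cmod (taylor_coeff f 0) \<le> 1"
    using f(2) by (simp add: taylor_coeff_def fps_expansion_def)
  have "(cmod z)\<^sup>2 \<le> (1 / 5)\<^sup>2" using z by (intro power_mono) auto
  also have "\<dots> \<le> (1 / 2 :: real)" by (simp add: power2_eq_square)
  finally have "bohr_lhs f z \<le> bohr_majorant (cmod (taylor_coeff f 0)) (cmod z)"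
    using f(2) by (intro bohr_lhs_le_majorant holo) auto
  also have "bohr_majorant (cmod (taylor_coeff f 0)) (cmod z) \<le> bohr_majorant (cmod (taylor_coeff f 0)) (1 / 5)"
    using a z by (intro bohr_majorant_mono) auto
  also have "\<dots> \<le> 1" using a by (intro bohr_majorant_le_1) auto
  finally show "bohr_lhs f z \<le> 1" .
next
  have a: "0 \<le> alpha" "alpha < 1" using alpha by auto
  show "disc_automorphism alpha analytic_on ball 0 1"
    using disc_automorphism_holomorphic[OF a] by (simp add: analytic_on_open)
  show "cmod (disc_automorphism alpha w) \<le> 1" if "w \<in> ball 0 1" for w
    using disc_automorphism_bounded(2)[OF a] that by simp
  show "\<exists>z. cmod z = 1 / 5 \<and> bohr_lhs (disc_automorphism alpha) z = 1"
    using bohr_lhs_disc_automorphism[OF a, of "1 / 5"] bohr_majorant_alpha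
    by (intro exI[of _ "of_real (1 / 5)"]) simp
qed

end
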